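(* Let $M$ be a connected, geodesically complete Riemannian manifold and let $\alpha>0$. Let $f\colon D\to\mathbb{R}$ be a strongly $\alpha$-self-concordant function defined on an open convex set $D\subseteq M$, with positive definite Hessian. Let $p\in D$ be a point such that $\lambda_{f,\alpha}(p)<1$. Then the Newton iterate remains in the domain, i.e., $p_{f,+}\in D$, and moreover $$\lambda_{f,\alpha}(p_{f,+})\le\left(\frac{\lambda_{f,\alpha}(p)}{1-\lambda_{f,\alpha}(p)}\right)^2.$$
   Context: Functions and manifolds are $C^\infty$-smooth; $\nabla$ is the Levi-Civita connection; $\operatorname{Exp}_p\colon T_pM\to M$ is the exponential map. Convexity: a subset $D\subseteq M$ is convex if every geodesic $\gamma\colon[0,1]\to M$ with $\gamma(0),\gamma(1)\in D$ satisfies $\gamma(t)\in D$ for all $t\in[0,1]$. A function $f\colon D\to\mathbb{R}$ on a convex set $D$ is convex if $f\circ\gamma$ is convex for every such geodesic. It is closed convex if in addition its epigraph $\{(p,t)\in D\times\mathbb{R}: f(p)\le t\}$ is a closed subset of $M\times\mathbb{R}$. $(\nabla^2f)_p$ denotes the Hessian (a symmetric bilinear form on $T_pM$), and $\nabla^3f=\nabla(\nabla^2f)$ the third covariant derivative, $(\nabla^3f)_p(u,v,w)=(\nabla_u(\nabla^2f))_p(v,w)$. Self-concordance: a convex function $f\colon D\to\mathbb{R}$ on an open convex $D\subseteq M$ is $\alpha$-self-concordant if for all $p\in D$ and $u,v,w\in T_pM$, $$|(\nabla^3f)_p(u,v,w)|\le\frac{2}{\sqrt\alpha}\sqrt{(\nabla^2f)_p(u,u)}\sqrt{(\nabla^2f)_p(v,v)}\sqrt{(\nabla^2f)_p(w,w)}.$$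 It is strongly $\alpha$-self-concordant if it is moreover closed convex. Newton iterate: $p_{f,+}:=\operatorname{Exp}_p(n_{f,p})$, where $n_{f,p}\in T_pM$ is the unique minimizer of $u\mapsto f(p)+df_p(u)+\frac12(\nabla^2f)_p(u,u)$, i.e. $(\nabla^2f)_p(n_{f,p},\cdot)=-df_p$. Newton decrement: $\lambda_{f,\alpha}(p)=\sup_{0\ne u\in T_pM}\frac{|df_p(u)|}{\sqrt{\alpha\,(\nabla^2f)_p(u,u)}}$. *)

theory Defs
  imports "HOL-Analysis.Analysis"
begin

section \<open>Smooth maps between Euclidean spaces\<close>

text \<open>The notions below are only used on open sets.\<close>

primrec Ck_on :: "nat \<Rightarrow> 'a::euclidean_space set \<Rightarrow> ('a \<Rightarrow> 'b::real_normed_vector) \<Rightarrow> bool" where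
  "Ck_on 0 S f \<longleftrightarrow> continuous_on S f"
| "Ck_on (Suc k) S f \<longleftrightarrow>
     (\<forall>x\<in>S. f differentiable (at x)) \<and>
     (\<forall>v. Ck_on k S (\<lambda>x. frechet_derivative f (at x) v))"

definition smooth_on :: "'a::euclidean_space set \<Rightarrow> ('a \<Rightarrow> 'b::real_normed_vector) \<Rightarrow> bool" where
  "smooth_on S f \<longleftrightarrow> (\<forall>k. Ck_on k S f)"

section \<open>Manifolds, tangent vectors, Riemannian metrics\<close>

text \<open>A chart is a coordinate map together with its domain; the values of the map outside
  its domain are irrelevant.\<close>

type_synonym ('m, 'e) chart = "'m set \<times> ('m \<Rightarrow> 'e)"

abbreviation chart_dom :: "('m, 'e) chart \<Rightarrow> 'm set" where
  "chart_dom c \<equiv> fst c"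

abbreviation coord :: "('m, 'e) chart \<Rightarrow> 'm \<Rightarrow> 'e" where
  "coord c \<equiv> snd c"

abbreviation chart_img :: "('m, 'e) chart \<Rightarrow> 'e set" where
  "chart_img c \<equiv> coord c ` chart_dom c"

definition chart_inv :: "('m, 'e) chart \<Rightarrow> 'e \<Rightarrow> 'm" where
  "chart_inv c = inv_into (chart_dom c) (coord c)"

definition is_chart :: "('m::topological_space, 'e::euclidean_space) chart \<Rightarrow> bool" where
  "is_chart c \<longleftrightarrow> open (chart_dom c) \<and> open (chart_img c) \<and>
     homeomorphism (chart_dom c) (chart_img c) (coord c) (chart_inv c)"

definition transition :: "('m, 'e) chart \<Rightarrow> ('m, 'e) chart \<Rightarrow> 'e \<Rightarrow> 'e" where
  "transition c c' = coord c' \<circ> chart_inv c"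

definition smooth_atlas :: "('m::topological_space, 'e::euclidean_space) chart set \<Rightarrow> bool" where
  "smooth_atlas A \<longleftrightarrow> (\<forall>c\<in>A. is_chart c) \<and> (\<Union>c\<in>A. chart_dom c) = UNIV \<and>
     (\<forall>c\<in>A. \<forall>c'\<in>A. smooth_on (coord c ` (chart_dom c \<inter> chart_dom c')) (transition c c'))"

text \<open>A tangent vector at a point is given by its components in all charts around that point,
  subject to the usual transformation law. It is set to 0 on everything that is not a chart of
  the atlas around the point, so that equality of tangent vectors is equality of functions.\<close>

type_synonym ('m, 'e) tvec = "('m, 'e) chart \<Rightarrow> 'e"

record ('m, 'e) riemannian =
  atlas :: "('m, 'e) chart set"
  riem_metric :: "'m \<Rightarrow> ('m, 'e) tvec \<Rightarrow> ('m, 'e) tvec \<Rightarrow> real"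

definition charts_at :: "('m, 'e) riemannian \<Rightarrow> 'm \<Rightarrow> ('m, 'e) chart set" where
  "charts_at M p = {c \<in> atlas M. p \<in> chart_dom c}"

definition tangent_space :: "('m, 'e::euclidean_space) riemannian \<Rightarrow> 'm \<Rightarrow> ('m, 'e) tvec set" where
  "tangent_space M p = {v.
     (\<forall>c\<in>charts_at M p. \<forall>c'\<in>charts_at M p.
        v c' = frechet_derivative (transition c c') (at (coord c p)) (v c)) \<and>
     (\<forall>c. c \<notin> charts_at M p \<longrightarrow> v c = 0)}"

text \<open>The tangent vector at \<open>p\<close> with components \<open>a\<close> in the chart \<open>c\<close>. For fixed \<open>a\<close> this is, as
  a function of \<open>p\<close>, a vector field on the domain of \<open>c\<close> with constant coefficients in \<open>c\<close>.\<close>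

definition tvec_of ::
  "('m, 'e::euclidean_space) riemannian \<Rightarrow> ('m, 'e) chart \<Rightarrow> 'm \<Rightarrow> 'e \<Rightarrow> ('m, 'e) tvec" where
  "tvec_of M c p a = (\<lambda>c'. if c' \<in> charts_at M p
     then frechet_derivative (transition c c') (at (coord c p)) a else 0)"

definition metric_coeff ::
  "('m, 'e::euclidean_space) riemannian \<Rightarrow> ('m, 'e) chart \<Rightarrow> 'e \<Rightarrow> 'e \<Rightarrow> 'e \<Rightarrow> real" where
  "metric_coeff M c x a b =
     (let q = chart_inv c x in riem_metric M q (tvec_of M c q a) (tvec_of M c q b))"

definition riemannian_manifold ::
  "('m::{t2_space, second_countable_topology}, 'e::euclidean_space) riemannian \<Rightarrow> bool" where
  "riemannian_manifold M \<longleftrightarrow> smooth_atlas (atlas M) \<and>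
     (\<forall>c\<in>atlas M.
        (\<forall>x\<in>chart_img c.
           bilinear (metric_coeff M c x) \<and>
           (\<forall>a b. metric_coeff M c x a b = metric_coeff M c x b a) \<and>
           (\<forall>a. a \<noteq> 0 \<longrightarrow> 0 < metric_coeff M c x a a)) \<and>
        (\<forall>a b. smooth_on (chart_img c) (\<lambda>x. metric_coeff M c x a b)))"

section \<open>Levi-Civita connection and geodesics\<close>

text \<open>\<open>christoffel M c x a b\<close> is \<open>\<nabla>\<^sub>A B\<close> at \<open>x\<close>, expressed in the chart \<open>c\<close>, for the vector fields
  \<open>A\<close> and \<open>B\<close> with constant coefficients \<open>a\<close> and \<open>b\<close> in \<open>c\<close>. Since such fields commute, the two
  last conditions say that the connection is torsion-free and compatible with the metric.\<close>

definition christoffel ::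
  "('m, 'e::euclidean_space) riemannian \<Rightarrow> ('m, 'e) chart \<Rightarrow> 'e \<Rightarrow> 'e \<Rightarrow> 'e \<Rightarrow> 'e" where
  "christoffel M c x = (THE \<Gamma>. bilinear \<Gamma> \<and>
     (\<forall>a b. \<Gamma> a b = \<Gamma> b a) \<and>
     (\<forall>u a b. frechet_derivative (\<lambda>y. metric_coeff M c y a b) (at x) u =
        metric_coeff M c x (\<Gamma> u a) b + metric_coeff M c x a (\<Gamma> u b)))"

definition geodesic_on ::
  "('m::topological_space, 'e::euclidean_space) riemannian \<Rightarrow> real set \<Rightarrow> (real \<Rightarrow> 'm) \<Rightarrow> bool" where
  "geodesic_on M I \<gamma> \<longleftrightarrow> continuous_on I \<gamma> \<and>
     (\<forall>c\<in>atlas M. \<exists>v. \<forall>t\<in>I. \<gamma> t \<in> chart_dom c \<longrightarrow>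
        ((coord c \<circ> \<gamma>) has_vector_derivative v t) (at t within I) \<and>
        (v has_vector_derivative - christoffel M c (coord c (\<gamma> t)) (v t) (v t)) (at t within I))"

definition velocity ::
  "('m, 'e::euclidean_space) riemannian \<Rightarrow> (real \<Rightarrow> 'm) \<Rightarrow> real \<Rightarrow> ('m, 'e) tvec" where
  "velocity M \<gamma> t = (\<lambda>c. if c \<in> charts_at M (\<gamma> t)
     then vector_derivative (coord c \<circ> \<gamma>) (at t) else 0)"

definition geodesic_from ::
  "('m::topological_space, 'e::euclidean_space) riemannian \<Rightarrow> 'm \<Rightarrow> ('m, 'e) tvec \<Rightarrow> (real \<Rightarrow> 'm) \<Rightarrow> bool" where
  "geodesic_from M p v \<gamma> \<longleftrightarrow> geodesic_on M UNIV \<gamma> \<and> \<gamma> 0 = p \<and> velocity M \<gamma> 0 = v"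

text \<open>Completeness says that the exponential map at every point is defined on the whole tangent
  space. As a geodesic is determined by its initial velocity, the choice made in \<open>Exp\<close> is
  immaterial.\<close>

definition geodesically_complete ::
  "('m::topological_space, 'e::euclidean_space) riemannian \<Rightarrow> bool" where
  "geodesically_complete M \<longleftrightarrow> (\<forall>p. \<forall>v\<in>tangent_space M p. \<exists>\<gamma>. geodesic_from M p v \<gamma>)"

definition Exp ::
  "('m::topological_space, 'e::euclidean_space) riemannian \<Rightarrow> 'm \<Rightarrow> ('m, 'e) tvec \<Rightarrow> 'm" where
  "Exp M p v = (SOME \<gamma>. geodesic_from M p v \<gamma>) 1"

section \<open>Differential and covariant derivatives\<close>

text \<open>The values of the following operators do not depend on the chart around \<open>p\<close>, so
  an arbitrary one is used.\<close>

definition chart_at :: "('m, 'e) riemannian \<Rightarrow> 'm \<Rightarrow> ('m, 'e) chart" where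
  "chart_at M p = (SOME c. c \<in> charts_at M p)"

definition differential ::
  "('m, 'e::euclidean_space) riemannian \<Rightarrow> ('m \<Rightarrow> real) \<Rightarrow> 'm \<Rightarrow> ('m, 'e) tvec \<Rightarrow> real" where
  "differential M f p v = (let c = chart_at M p in
     frechet_derivative (f \<circ> chart_inv c) (at (coord c p)) (v c))"

text \<open>The covariant derivatives of a covariant 1-tensor \<open>\<omega>\<close> and of a covariant 2-tensor \<open>T\<close>:
  \<open>(\<nabla>\<^sub>u \<omega>)(v) = u(\<omega>(V)) - \<omega>(\<nabla>\<^sub>u V)\<close> and
  \<open>(\<nabla>\<^sub>u T)(v, w) = u(T(V, W)) - T(\<nabla>\<^sub>u V, w) - T(v, \<nabla>\<^sub>u W)\<close>, where \<open>V\<close> and \<open>W\<close> are the extensions of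
  \<open>v\<close> and \<open>w\<close> with constant coefficients in the chart.\<close>

definition cov_deriv1 ::
  "('m, 'e::euclidean_space) riemannian \<Rightarrow> ('m \<Rightarrow> ('m, 'e) tvec \<Rightarrow> real) \<Rightarrow>
   'm \<Rightarrow> ('m, 'e) tvec \<Rightarrow> ('m, 'e) tvec \<Rightarrow> real" where
  "cov_deriv1 M \<omega> p u v = (let c = chart_at M p; x = coord c p in
     frechet_derivative (\<lambda>y. \<omega> (chart_inv c y) (tvec_of M c (chart_inv c y) (v c))) (at x) (u c)
     - \<omega> p (tvec_of M c p (christoffel M c x (u c) (v c))))"

definition cov_deriv2 ::
  "('m, 'e::euclidean_space) riemannian \<Rightarrow> ('m \<Rightarrow> ('m, 'e) tvec \<Rightarrow> ('m, 'e) tvec \<Rightarrow> real) \<Rightarrow>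
   'm \<Rightarrow> ('m, 'e) tvec \<Rightarrow> ('m, 'e) tvec \<Rightarrow> ('m, 'e) tvec \<Rightarrow> real" where
  "cov_deriv2 M T p u v w = (let c = chart_at M p; x = coord c p in
     frechet_derivative (\<lambda>y. T (chart_inv c y) (tvec_of M c (chart_inv c y) (v c))
        (tvec_of M c (chart_inv c y) (w c))) (at x) (u c)
     - T p (tvec_of M c p (christoffel M c x (u c) (v c))) w
     - T p v (tvec_of M c p (christoffel M c x (u c) (w c))))"

definition hessian ::
  "('m, 'e::euclidean_space) riemannian \<Rightarrow> ('m \<Rightarrow> real) \<Rightarrow> 'm \<Rightarrow> ('m, 'e) tvec \<Rightarrow> ('m, 'e) tvec \<Rightarrow> real" where
  "hessian M f = cov_deriv1 M (differential M f)"

definition third_deriv ::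
  "('m, 'e::euclidean_space) riemannian \<Rightarrow> ('m \<Rightarrow> real) \<Rightarrow>
   'm \<Rightarrow> ('m, 'e) tvec \<Rightarrow> ('m, 'e) tvec \<Rightarrow> ('m, 'e) tvec \<Rightarrow> real" where
  "third_deriv M f = cov_deriv2 M (hessian M f)"

section \<open>Convexity and self-concordance\<close>

text \<open>Functions \<open>D \<rightarrow> \<real>\<close> are represented by total functions; only their values on \<open>D\<close> matter.\<close>

definition geod_convex_set ::
  "('m::topological_space, 'e::euclidean_space) riemannian \<Rightarrow> 'm set \<Rightarrow> bool" where
  "geod_convex_set M D \<longleftrightarrow> (\<forall>\<gamma>. geodesic_on M {0..1} \<gamma> \<and> \<gamma> 0 \<in> D \<and> \<gamma> 1 \<in> D \<longrightarrow>
     (\<forall>t\<in>{0..1}. \<gamma> t \<in> D))"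

definition geod_convex_on ::
  "('m::topological_space, 'e::euclidean_space) riemannian \<Rightarrow> 'm set \<Rightarrow> ('m \<Rightarrow> real) \<Rightarrow> bool" where
  "geod_convex_on M D f \<longleftrightarrow> geod_convex_set M D \<and>
     (\<forall>\<gamma>. geodesic_on M {0..1} \<gamma> \<and> \<gamma> 0 \<in> D \<and> \<gamma> 1 \<in> D \<longrightarrow> convex_on {0..1} (f \<circ> \<gamma>))"

definition closed_geod_convex_on ::
  "('m::topological_space, 'e::euclidean_space) riemannian \<Rightarrow> 'm set \<Rightarrow> ('m \<Rightarrow> real) \<Rightarrow> bool" where
  "closed_geod_convex_on M D f \<longleftrightarrow> geod_convex_on M D f \<and> closed {(p, t). p \<in> D \<and> f p \<le> t}"

definition smooth_function_on ::
  "('m, 'e::euclidean_space) riemannian \<Rightarrow> 'm set \<Rightarrow> ('m \<Rightarrow> real) \<Rightarrow> bool" where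
  "smooth_function_on M D f \<longleftrightarrow>
     (\<forall>c\<in>atlas M. smooth_on (coord c ` (chart_dom c \<inter> D)) (f \<circ> chart_inv c))"

definition self_concordant ::
  "('m::topological_space, 'e::euclidean_space) riemannian \<Rightarrow> 'm set \<Rightarrow> ('m \<Rightarrow> real) \<Rightarrow> real \<Rightarrow> bool" where
  "self_concordant M D f \<alpha> \<longleftrightarrow>
     open D \<and> smooth_function_on M D f \<and> geod_convex_on M D f \<and>
     (\<forall>p\<in>D. \<forall>u\<in>tangent_space M p. \<forall>v\<in>tangent_space M p. \<forall>w\<in>tangent_space M p.
        \<bar>third_deriv M f p u v w\<bar> \<le> 2 / sqrt \<alpha> *
          sqrt (hessian M f p u u) * sqrt (hessian M f p v v) * sqrt (hessian M f p w w))"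

definition strongly_self_concordant ::
  "('m::topological_space, 'e::euclidean_space) riemannian \<Rightarrow> 'm set \<Rightarrow> ('m \<Rightarrow> real) \<Rightarrow> real \<Rightarrow> bool" where
  "strongly_self_concordant M D f \<alpha> \<longleftrightarrow> self_concordant M D f \<alpha> \<and> closed_geod_convex_on M D f"

definition pos_def_hessian_on ::
  "('m, 'e::euclidean_space) riemannian \<Rightarrow> 'm set \<Rightarrow> ('m \<Rightarrow> real) \<Rightarrow> bool" where
  "pos_def_hessian_on M D f \<longleftrightarrow>
     (\<forall>p\<in>D. \<forall>u\<in>tangent_space M p. u \<noteq> (\<lambda>_. 0) \<longrightarrow> 0 < hessian M f p u u)"

section \<open>Newton's method\<close>

definition newton_step ::
  "('m, 'e::euclidean_space) riemannian \<Rightarrow> ('m \<Rightarrow> real) \<Rightarrow> 'm \<Rightarrow> ('m, 'e) tvec" where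
  "newton_step M f p = (THE n. is_arg_min
     (\<lambda>u. f p + differential M f p u + hessian M f p u u / 2) (\<lambda>u. u \<in> tangent_space M p) n)"

definition newton_iterate ::
  "('m::topological_space, 'e::euclidean_space) riemannian \<Rightarrow> ('m \<Rightarrow> real) \<Rightarrow> 'm \<Rightarrow> 'm" where
  "newton_iterate M f p = Exp M p (newton_step M f p)"

definition newton_decrement ::
  "('m, 'e::euclidean_space) riemannian \<Rightarrow> ('m \<Rightarrow> real) \<Rightarrow> real \<Rightarrow> 'm \<Rightarrow> real" where
  "newton_decrement M f \<alpha> p = (SUP u\<in>tangent_space M p - {\<lambda>_. 0}.
     \<bar>differential M f p u\<bar> / sqrt (\<alpha> * hessian M f p u u))"

end

theory Submission
  imports Defs
begin

text \<open>Let \<open>\<gamma>\<close> be the geodesic with \<open>\<gamma> 0 = p\<close> whose initial velocity is the Newton step, write \<open>\<nu>\<close> for the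
  Newton decrement at \<open>p\<close>, \<open>v\<close> for the velocity of \<open>\<gamma>\<close> and \<open>H\<close> for the Hessian of \<open>f\<close>. The Newton
  equation \<open>H(v, \<cdot>) = -df\<close> at \<open>p\<close> gives \<open>H(v, v) \<le> \<alpha> \<nu>\<^sup>2\<close> at time 0. Everything happens along \<open>\<gamma>\<close>, by
  comparing two quantities with explicit barriers.

  The first quantity is the squared speed \<open>H(v, v)\<close>. It is the second derivative of \<open>f\<close> along \<open>\<gamma>\<close>, and
  its derivative is the third covariant derivative, so self-concordance keeps it below
  \<open>\<alpha> (\<mu> / (1 - t \<mu>))\<^sup>2\<close> for every \<open>\<mu>\<close> with \<open>\<nu> < \<mu> < 1\<close>. As long as this bound holds, \<open>f\<close> stays bounded
  along \<open>\<gamma>\<close>, and since the epigraph of \<open>f\<close> is closed, \<open>\<gamma>\<close> cannot leave \<open>D\<close> before time 1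
  (\<open>geodesic_stays_in_domain\<close>).

  The second quantity is the covector \<open>\<theta> = df + (1 - t) H(v, \<cdot>)\<close> at time \<open>t\<close>. By the Newton equation it
  vanishes at time 0; at time 1 it is the differential to be estimated. Its covariant derivative along
  \<open>\<gamma>\<close> is \<open>(1 - t) (\<nabla>\<^sub>v H)(v, \<cdot>)\<close>, because the two contributions \<open>H(v, \<cdot>)\<close> cancel. With the bound on
  \<open>H(v, v)\<close>, self-concordance controls both this derivative and the change of the dual norm of \<open>H\<close>, and
  the resulting linear differential inequality for the dual norm of \<open>\<theta>\<close> gives at time 1 at most
  \<open>(\<mu> / (1 - \<mu>))\<^sup>2\<close>, up to the factor \<open>\<surd>\<alpha>\<close> and an arbitrarily small error
  (\<open>differential_barrier\<close>). Letting \<open>\<mu>\<close> decrease to \<open>\<nu>\<close> proves the theorem.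

  The dual norm is never differentiated. The statement \<open>\<theta>(w) < b(t) \<surd>H(w, w)\<close> for all tangent vectors
  \<open>w \<noteq> 0\<close> is propagated from time 0 to time 1 by continuous induction: it is open in \<open>t\<close> because the unit
  sphere is compact, and it passes to the limit because \<open>w\<close> extends to a field along \<open>\<gamma>\<close> with vanishing
  covariant derivative at that one time, along which the difference of the two sides has negative
  derivative.

  For the computations in charts, the value of \<open>H\<close> must not depend on the chart. On the diagonal it is the
  second derivative of \<open>f\<close> along a geodesic, which involves no chart, and a symmetric bilinear form is
  determined by its diagonal (\<open>hess_in_change_chart\<close>). Differentiating \<open>H\<close> once more uses that the
  Christoffel symbols, which solve a linear system with differentiable coefficients, are differentiable.\<close>

section \<open>Derivatives and their symmetry\<close>

lemma smooth_on_differentiable: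
  "smooth_on S f \<Longrightarrow> x \<in> S \<Longrightarrow> f differentiable (at x)"
  unfolding smooth_on_def using Ck_on.simps(2) by blast

lemma smooth_on_frechet_derivative:
  "smooth_on S f \<Longrightarrow> smooth_on S (\<lambda>x. frechet_derivative f (at x) v)"
  unfolding smooth_on_def using Ck_on.simps(2) by blast

lemma has_vector_derivative_along_curve:
  fixes X :: "real \<Rightarrow> 'a::real_normed_vector" and F :: "'a \<Rightarrow> 'b::real_normed_vector"
  assumes X: "(X has_vector_derivative X') (at t)" and F: "F differentiable (at (X t))"
  shows "((\<lambda>s. F (X s)) has_vector_derivative frechet_derivative F (at (X t)) X') (at t)"
proof -
  have F': "(F has_derivative frechet_derivative F (at (X t))) (at (X t))"
    using F frechet_derivative_works by blast
  have "((\<lambda>s. F (X s)) has_derivative (\<lambda>h. frechet_derivative F (at (X t)) (h *\<^sub>R X'))) (at t)"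
    using has_derivative_compose[OF X[unfolded has_vector_derivative_def] F'] .
  then show ?thesis
    unfolding has_vector_derivative_def
    using linear_cmul[OF has_derivative_linear[OF F']] by simp
qed

lemma has_vector_derivative_cong_nhds:
  assumes "(X has_vector_derivative d) (at t)" and "\<forall>\<^sub>F s in nhds t. X s = Y s"
  shows "(Y has_vector_derivative d) (at t)"
proof -
  obtain S where S: "open S" "t \<in> S" "\<And>s. s \<in> S \<Longrightarrow> X s = Y s"
    using assms(2) unfolding eventually_nhds by blast
  show ?thesis by (rule has_vector_derivative_transform_within_open[OF assms(1) S])
qed

lemma has_real_derivative_cong_nhds:
  "(X has_real_derivative d) (at t) \<Longrightarrow> \<forall>\<^sub>F s in nhds t. X s = Y s \<Longrightarrow>
     (Y has_real_derivative d) (at t)"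
  unfolding has_real_derivative_iff_has_vector_derivative by (rule has_vector_derivative_cong_nhds)

lemma frechet_derivative_eqI:
  "(f has_derivative f') (at x) \<Longrightarrow> frechet_derivative f (at x) a = f' a"
  by (simp add: frechet_derivative_at[symmetric])

lemma frechet_derivative_cong_open:
  assumes "f differentiable (at x)" and "open S" "x \<in> S" and "\<And>y. y \<in> S \<Longrightarrow> f y = g y"
  shows "frechet_derivative g (at x) = frechet_derivative f (at x)"
proof -
  have "(f has_derivative frechet_derivative f (at x)) (at x)"
    using assms(1) by (simp only: frechet_derivative_works)
  then have "(g has_derivative frechet_derivative f (at x)) (at x)"
    by (rule has_derivative_transform_within_open[OF _ assms(2-4)])
  then show ?thesis by (rule frechet_derivative_at[symmetric])
qed

text \<open>The mean value theorem, applied to the difference between \<open>F\<close> on the segment from \<open>x + h v\<close> in direction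
  \<open>u\<close> and on the segment from \<open>x\<close> in direction \<open>u\<close>, turns the second difference into an increment of the
  derivative along \<open>u\<close>.\<close>

lemma second_difference_limit:
  fixes F :: "'a::euclidean_space \<Rightarrow> real"
  assumes S: "open S" "x \<in> S" and F: "\<And>y. y \<in> S \<Longrightarrow> F differentiable (at y)"
    and d: "((\<lambda>y. frechet_derivative F (at y) u) has_derivative G) (at x)"
  shows "((\<lambda>h. (F (x + h *\<^sub>R u + h *\<^sub>R v) - F (x + h *\<^sub>R u) - F (x + h *\<^sub>R v) + F x) / h\<^sup>2)
     \<longlongrightarrow> G v) (at_right 0)"
proof -
  define \<Delta> where "\<Delta> h = F (x + h *\<^sub>R u + h *\<^sub>R v) - F (x + h *\<^sub>R u) - F (x + h *\<^sub>R v) + F x" for h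
  define g where "g y = frechet_derivative F (at y) u" for y
  have G: "linear G" using d has_derivative_linear by blast
  define K where "K = norm u + norm v + 1"
  have K: "K > 0" unfolding K_def by (simp add: add_nonneg_pos)
  obtain r where r: "r > 0" "ball x r \<subseteq> S" using S open_contains_ball by blast
  have "\<exists>d>0. \<forall>h. 0 < h \<and> h < d \<longrightarrow> \<bar>\<Delta> h / h\<^sup>2 - G v\<bar> < e" if e: "e > 0" for e
  proof -
    \<comment> \<open>The points involved are at distance at most \<open>h K\<close> from \<open>x\<close>, and the linear approximation is used at two
      of them, so this choice leaves an error of \<open>e / 2\<close>.\<close>
    define e' where "e' = e / (4 * K)"
    have e': "e' > 0" using e K by (simp add: e'_def)
    obtain d where d0: "d > 0" and dd: "\<And>y. norm (y - x) < d \<Longrightarrow> \<bar>g y - g x - G (y - x)\<bar> \<le> e' * norm (y - x)"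
      using d e' unfolding has_derivative_at_alt g_def[symmetric] real_norm_def by blast
    show ?thesis
    proof (intro exI[of _ "min d r / K"] conjI allI impI)
      show "min d r / K > 0" using d0 r K by simp
      fix h assume h: "0 < h \<and> h < min d r / K"
      then have hK: "h * K < d" "h * K < r" using K by (auto simp: field_simps)
      have small: "norm (s *\<^sub>R u + c *\<^sub>R v) \<le> h * K" if "0 \<le> s" "s \<le> h" "0 \<le> c" "c \<le> h" for s c
      proof -
        have "norm (s *\<^sub>R u + c *\<^sub>R v) \<le> s * norm u + c * norm v"
          using norm_triangle_ineq[of "s *\<^sub>R u" "c *\<^sub>R v"] that by simp
        also have "\<dots> \<le> h * norm u + h * norm v" using that by (intro add_mono mult_right_mono) auto
        also have "\<dots> \<le> h * K" using h by (simp add: K_def algebra_simps)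
        finally show ?thesis .
      qed
      have inS: "x + (s *\<^sub>R u + c *\<^sub>R v) \<in> S" if "0 \<le> s" "s \<le> h" "0 \<le> c" "c \<le> h" for s c
      proof -
        have "dist (x + (s *\<^sub>R u + c *\<^sub>R v)) x < r" using small[OF that] hK by (simp add: dist_norm)
        then show ?thesis using r by (auto simp: dist_commute)
      qed
      define \<psi> where "\<psi> s = F (x + (s *\<^sub>R u + h *\<^sub>R v)) - F (x + (s *\<^sub>R u + 0 *\<^sub>R v))" for s
      have one: "((\<lambda>s. F (x + (s *\<^sub>R u + c *\<^sub>R v))) has_real_derivative g (x + (s *\<^sub>R u + c *\<^sub>R v))) (at s)"
        if "0 \<le> s" "s \<le> h" "0 \<le> c" "c \<le> h" for s c
      proof -
        have "((\<lambda>s. x + (s *\<^sub>R u + c *\<^sub>R v)) has_vector_derivative u) (at s)"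
          by (auto intro!: derivative_eq_intros)
        then have "((\<lambda>s. F (x + (s *\<^sub>R u + c *\<^sub>R v))) has_vector_derivative g (x + (s *\<^sub>R u + c *\<^sub>R v))) (at s)"
          unfolding g_def by (rule has_vector_derivative_along_curve) (rule F[OF inS[OF that]])
        then show ?thesis by (simp add: has_real_derivative_iff_has_vector_derivative o_def)
      qed
      have "\<exists>z>0. z < h \<and> \<psi> h - \<psi> 0 = (h - 0) * (g (x + (z *\<^sub>R u + h *\<^sub>R v)) - g (x + (z *\<^sub>R u + 0 *\<^sub>R v)))"
        using h unfolding \<psi>_def by (intro MVT2 DERIV_diff one) auto
      then obtain z where z: "0 < z" "z < h"
        and mvt: "\<psi> h - \<psi> 0 = h * (g (x + (z *\<^sub>R u + h *\<^sub>R v)) - g (x + (z *\<^sub>R u + 0 *\<^sub>R v)))" by auto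
      have \<Delta>: "\<Delta> h = \<psi> h - \<psi> 0" unfolding \<Delta>_def \<psi>_def by (simp add: add.assoc)
      have b1: "\<bar>g (x + (z *\<^sub>R u + c *\<^sub>R v)) - g x - G (z *\<^sub>R u + c *\<^sub>R v)\<bar> \<le> e' * (h * K)"
        if "0 \<le> c" "c \<le> h" for c
      proof -
        have "norm (z *\<^sub>R u + c *\<^sub>R v) \<le> h * K" using small z that by simp
        then show ?thesis using dd[of "x + (z *\<^sub>R u + c *\<^sub>R v)"] hK e'
          by (smt (verit) add_diff_cancel_left' mult_left_mono)
      qed
      have "G (z *\<^sub>R u + h *\<^sub>R v) - G (z *\<^sub>R u + 0 *\<^sub>R v) = h * G v"
        using G by (simp add: linear_add linear_cmul)
      then have "\<bar>g (x + (z *\<^sub>R u + h *\<^sub>R v)) - g (x + (z *\<^sub>R u + 0 *\<^sub>R v)) - h * G v\<bar> \<le> 2 * e' * (h * K)"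
        using b1[of h] b1[of 0] h by linarith
      also have "\<dots> = h * (e / 2)" using K by (simp add: e'_def)
      finally have "h * \<bar>g (x + (z *\<^sub>R u + h *\<^sub>R v)) - g (x + (z *\<^sub>R u + 0 *\<^sub>R v)) - h * G v\<bar> \<le> h * (h * (e / 2))"
        using h by (intro mult_left_mono) auto
      moreover have "\<Delta> h - h\<^sup>2 * G v = h * (g (x + (z *\<^sub>R u + h *\<^sub>R v)) - g (x + (z *\<^sub>R u + 0 *\<^sub>R v)) - h * G v)"
        unfolding \<Delta> mvt by (simp add: power2_eq_square right_diff_distrib)
      ultimately have "\<bar>\<Delta> h - h\<^sup>2 * G v\<bar> \<le> h\<^sup>2 * (e / 2)"
        using h by (simp add: abs_mult power2_eq_square)
      moreover have "\<Delta> h / h\<^sup>2 - G v = (\<Delta> h - h\<^sup>2 * G v) / h\<^sup>2" using h by (simp add: diff_divide_distrib)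
      ultimately have "\<bar>\<Delta> h / h\<^sup>2 - G v\<bar> \<le> e / 2" using h by (simp add: field_simps)
      then show "\<bar>\<Delta> h / h\<^sup>2 - G v\<bar> < e" using e by simp
    qed
  qed
  then have "((\<lambda>h. \<Delta> h / h\<^sup>2) \<longlongrightarrow> G v) (at_right 0)"
    unfolding tendsto_iff eventually_at_right_field dist_real_def by (metis)
  then show ?thesis unfolding \<Delta>_def .
qed

text \<open>The second difference is symmetric in the two directions, hence so is its limit.\<close>

lemma symmetric_second_derivative:
  fixes F :: "'a::euclidean_space \<Rightarrow> real"
  assumes S: "open S" "x \<in> S" and F: "smooth_on S F"
  shows "frechet_derivative (\<lambda>y. frechet_derivative F (at y) u) (at x) v
    = frechet_derivative (\<lambda>y. frechet_derivative F (at y) v) (at x) u"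
proof -
  have F1: "F differentiable (at y)" if "y \<in> S" for y
    using smooth_on_differentiable[OF F that] .
  have d: "((\<lambda>y. frechet_derivative F (at y) w) has_derivative
     frechet_derivative (\<lambda>y. frechet_derivative F (at y) w) (at x)) (at x)" for w
    using smooth_on_differentiable[OF smooth_on_frechet_derivative[OF F] S(2)] frechet_derivative_works by blast
  have sym: "(\<lambda>h. (F (x + h *\<^sub>R v + h *\<^sub>R u) - F (x + h *\<^sub>R v) - F (x + h *\<^sub>R u) + F x) / h\<^sup>2)
     = (\<lambda>h. (F (x + h *\<^sub>R u + h *\<^sub>R v) - F (x + h *\<^sub>R u) - F (x + h *\<^sub>R v) + F x) / h\<^sup>2)"
    by (rule ext) (simp add: algebra_simps)
  show ?thesis
    by (rule tendsto_unique[OF _ second_difference_limit[OF S F1 d, of u v]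
          second_difference_limit[OF S F1 d, of v u, unfolded sym]]) simp_all
qed

section \<open>Families of linear and bilinear forms\<close>

lemma linear_eq_sum_Basis:
  fixes g :: "'e::euclidean_space \<Rightarrow> real"
  assumes "linear g"
  shows "g u = (\<Sum>b\<in>Basis. (u \<bullet> b) * g b)"
proof -
  have "g u = g (\<Sum>b\<in>Basis. (u \<bullet> b) *\<^sub>R b)" by (simp add: euclidean_representation)
  also have "\<dots> = (\<Sum>b\<in>Basis. (u \<bullet> b) * g b)"
    using assms by (simp add: linear_sum linear_cmul)
  finally show ?thesis .
qed

lemma bilinear_left: "bilinear h \<Longrightarrow> linear (\<lambda>a. h a b)"
  and bilinear_right: "bilinear h \<Longrightarrow> linear (h a)"
  by (auto simp: bilinear_def)

text \<open>The operator that represents \<open>g\<close> is injective, because \<open>g z z = 0\<close> forces \<open>z = 0\<close>, and therefore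
  surjective.\<close>

lemma positive_definite_solvable:
  fixes g :: "'e::euclidean_space \<Rightarrow> 'e \<Rightarrow> real" and k :: "'e \<Rightarrow> real"
  assumes g: "bilinear g" and pos: "\<And>a. a \<noteq> 0 \<Longrightarrow> 0 < g a a" and k: "linear k"
  shows "\<exists>z. \<forall>b. g z b = k b"
proof -
  define L where "L z = (\<Sum>b\<in>Basis. g z b *\<^sub>R b)" for z
  have lin: "linear L"
    unfolding L_def
    by (rule linearI)
      (simp_all add: bilinear_ladd[OF g] bilinear_lmul[OF g] scaleR_add_left sum.distrib scaleR_sum_right)
  have L: "L z \<bullet> b = g z b" for z b
    using linear_eq_sum_Basis[OF bilinear_right[OF g], of z b]
    by (simp add: L_def inner_sum_left inner_sum_right inner_commute[of _ b] mult.commute)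
  have "inj L"
  proof (rule linear_injective_0[THEN iffD2, rule_format, OF lin])
    fix z assume "L z = 0"
    then have "g z z = 0" using L[of z z] by simp
    then show "z = 0" using pos[of z] by force
  qed
  then have "surj L" using lin linear_injective_imp_surjective by blast
  then obtain z where z: "L z = (\<Sum>b\<in>Basis. k b *\<^sub>R b)" by (metis surjD)
  have "g z b = k b" for b
    using linear_eq_sum_Basis[OF k, of b]
    by (simp add: L[symmetric] z inner_sum_left inner_sum_right inner_commute[of _ b] mult.commute)
  then show ?thesis by blast
qed

lemma bilinear_Cauchy_Schwarz:
  fixes g :: "'e::real_vector \<Rightarrow> 'e \<Rightarrow> real"
  assumes g: "bilinear g" and sym: "\<And>a b. g a b = g b a" and pos: "\<And>a. a \<noteq> 0 \<Longrightarrow> 0 < g a a"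
  shows "\<bar>g a b\<bar> \<le> sqrt (g a a) * sqrt (g b b)"
proof (cases "b = 0")
  case True
  then show ?thesis using bilinear_rzero[OF g] by simp
next
  case False
  have nonneg: "0 \<le> g a a" for a
    using pos[of a] bilinear_rzero[OF g] by (cases "a = 0") (auto simp: less_imp_le)
  define t where "t = g a b / g b b"
  have "0 \<le> g (a - t *\<^sub>R b) (a - t *\<^sub>R b)" by (rule nonneg)
  also have "\<dots> = g a a - 2 * t * g a b + t\<^sup>2 * g b b"
    by (simp add: bilinear_lsub[OF g] bilinear_rsub[OF g] bilinear_lmul[OF g] bilinear_rmul[OF g]
        sym[of b a] power2_eq_square algebra_simps)
  also have "\<dots> = g a a - (g a b)\<^sup>2 / g b b"
    using pos[OF False] by (simp add: t_def power2_eq_square field_simps)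
  finally have "(g a b)\<^sup>2 \<le> g a a * g b b"
    using pos[OF False] by (simp add: field_simps)
  then have "sqrt ((g a b)\<^sup>2) \<le> sqrt (g a a * g b b)" by (rule real_sqrt_le_mono)
  then show ?thesis by (simp add: real_sqrt_mult)
qed

text \<open>In a basis the value is a finite sum of products of a coordinate of the argument and a coefficient of
  the form, so differentiability of the coefficients suffices for joint differentiability.\<close>

lemma linear_family_has_derivative:
  fixes B :: "'a::real_normed_vector \<Rightarrow> 'e::euclidean_space \<Rightarrow> real"
  assumes S: "open S" "x \<in> S" and lin: "\<And>y. y \<in> S \<Longrightarrow> linear (B y)"
    and d: "\<And>u. ((\<lambda>y. B y u) has_derivative B' u) (at x)"
  shows "((\<lambda>q. B (fst q) (snd q)) has_derivative (\<lambda>h. B' w (fst h) + B x (snd h))) (at (x, w))"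
proof -
  have expand: "B y u = (\<Sum>b\<in>Basis. (u \<bullet> b) * B y b)" if "y \<in> S" for y u
    using linear_eq_sum_Basis[OF lin[OF that]] .
  have d2: "((\<lambda>q. B (fst q) b) has_derivative (\<lambda>h. B' b (fst h))) (at (x, w))" for b
    using has_derivative_compose[OF has_derivative_fst[OF has_derivative_ident], of "\<lambda>y. B y b" "B' b" "(x, w)"]
      d[of b] by simp
  have "((\<lambda>q. \<Sum>b\<in>Basis. (snd q \<bullet> b) * B (fst q) b) has_derivative
     (\<lambda>h. \<Sum>b\<in>Basis. (w \<bullet> b) * B' b (fst h) + (snd h \<bullet> b) * B x b)) (at (x, w))"
    by (auto intro!: derivative_eq_intros d2)
  then have *: "((\<lambda>q. B (fst q) (snd q)) has_derivative
     (\<lambda>h. \<Sum>b\<in>Basis. (w \<bullet> b) * B' b (fst h) + (snd h \<bullet> b) * B x b)) (at (x, w))"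
    by (rule has_derivative_transform_within_open[where s = "S \<times> UNIV"])
       (use S in \<open>auto simp: expand[symmetric] open_Times\<close>)
  have "((\<lambda>y. \<Sum>b\<in>Basis. (w \<bullet> b) * B y b) has_derivative (\<lambda>h. \<Sum>b\<in>Basis. (w \<bullet> b) * B' b h)) (at x)"
    by (auto intro!: derivative_eq_intros d)
  then have "((\<lambda>y. B y w) has_derivative (\<lambda>h. \<Sum>b\<in>Basis. (w \<bullet> b) * B' b h)) (at x)"
    by (rule has_derivative_transform_within_open[where s = S])
       (use S in \<open>auto simp: expand[symmetric]\<close>)
  then have "B' w = (\<lambda>h. \<Sum>b\<in>Basis. (w \<bullet> b) * B' b h)"
    using d has_derivative_unique by blast
  then have "(\<Sum>b\<in>Basis. (w \<bullet> b) * B' b h + (k \<bullet> b) * B x b) = B' w h + B x k" for h k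
    using S by (simp add: sum.distrib expand[of x k])
  with * show ?thesis by simp
qed

text \<open>A bilinear family is a linear family in its last argument with the parameter and the first argument
  together as a new parameter.\<close>

lemma bilinear_family_has_derivative:
  fixes B :: "'a::real_normed_vector \<Rightarrow> 'e::euclidean_space \<Rightarrow> 'e \<Rightarrow> real"
  assumes S: "open S" "x \<in> S" and bil: "\<And>y. y \<in> S \<Longrightarrow> bilinear (B y)"
    and d: "\<And>u v. ((\<lambda>y. B y u v) has_derivative B' u v) (at x)"
  shows "((\<lambda>q. B (fst (fst q)) (snd (fst q)) (snd q)) has_derivative
     (\<lambda>h. B' a w (fst (fst h)) + B x (snd (fst h)) w + B x a (snd h))) (at ((x, a), w))"
proof -
  have "((\<lambda>q. (\<lambda>r. B (fst r) (snd r)) (fst q) (snd q)) has_derivative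
     (\<lambda>h. (\<lambda>u h. B' a u (fst h) + B x (snd h) u) w (fst h) + (\<lambda>r. B (fst r) (snd r)) (x, a) (snd h)))
     (at ((x, a), w))"
  proof (rule linear_family_has_derivative)
    show "open (S \<times> (UNIV::'e set))" using S by (simp add: open_Times)
    show "(x, a) \<in> S \<times> UNIV" using S by simp
    show "linear (B (fst r) (snd r))" if "r \<in> S \<times> UNIV" for r
      using bil[of "fst r"] that by (auto simp: bilinear_def)
    show "((\<lambda>r. B (fst r) (snd r) u) has_derivative (\<lambda>h. B' a u (fst h) + B x (snd h) u)) (at (x, a))" for u
      by (rule linear_family_has_derivative[OF S, where B = "\<lambda>y c. B y c u"])
         (use bil d in \<open>auto simp: bilinear_def\<close>)
  qed
  then show ?thesis by simp
qed

lemma frechet_derivative_linear_family: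
  fixes B :: "'a::real_normed_vector \<Rightarrow> 'b::real_vector \<Rightarrow> real"
  assumes S: "open S" "x \<in> S" and lin: "\<And>y. y \<in> S \<Longrightarrow> linear (B y)"
    and d: "\<And>a. (\<lambda>y. B y a) differentiable (at x)"
  shows "linear (\<lambda>a. frechet_derivative (\<lambda>y. B y a) (at x) u)"
proof -
  have d': "((\<lambda>y. B y a) has_derivative frechet_derivative (\<lambda>y. B y a) (at x)) (at x)" for a
    using d frechet_derivative_works by blast
  show ?thesis
  proof (rule linearI)
    fix a b
    have "((\<lambda>y. B y a + B y b) has_derivative
        (\<lambda>h. frechet_derivative (\<lambda>y. B y a) (at x) h + frechet_derivative (\<lambda>y. B y b) (at x) h)) (at x)"
      by (intro has_derivative_add d')
    then have "((\<lambda>y. B y (a + b)) has_derivative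
        (\<lambda>h. frechet_derivative (\<lambda>y. B y a) (at x) h + frechet_derivative (\<lambda>y. B y b) (at x) h)) (at x)"
      by (rule has_derivative_transform_within_open[OF _ S]) (simp add: linear_add[OF lin])
    then show "frechet_derivative (\<lambda>y. B y (a + b)) (at x) u =
        frechet_derivative (\<lambda>y. B y a) (at x) u + frechet_derivative (\<lambda>y. B y b) (at x) u"
      by (rule frechet_derivative_eqI)
  next
    fix r a
    have "((\<lambda>y. r * B y a) has_derivative (\<lambda>h. r * frechet_derivative (\<lambda>y. B y a) (at x) h)) (at x)"
      by (intro has_derivative_mult_right d')
    then have "((\<lambda>y. B y (r *\<^sub>R a)) has_derivative (\<lambda>h. r * frechet_derivative (\<lambda>y. B y a) (at x) h)) (at x)"
      by (rule has_derivative_transform_within_open[OF _ S]) (simp add: linear_cmul[OF lin])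
    then show "frechet_derivative (\<lambda>y. B y (r *\<^sub>R a)) (at x) u = r *\<^sub>R frechet_derivative (\<lambda>y. B y a) (at x) u"
      unfolding real_scaleR_def by (rule frechet_derivative_eqI)
  qed
qed

text \<open>These product rules are the coordinate form of the rule \<open>(T(V, W))' = T'(V, W) + T(V', W) + T(V, W')\<close>
  for covariant tensors along a curve.\<close>

lemma linear_family_along_curve:
  fixes B :: "'a::real_normed_vector \<Rightarrow> 'e::euclidean_space \<Rightarrow> real"
  assumes S: "open S" "X t \<in> S" and lin: "\<And>y. y \<in> S \<Longrightarrow> linear (B y)"
    and d: "\<And>u. (\<lambda>y. B y u) differentiable (at (X t))"
    and X: "(X has_vector_derivative X') (at t)" and W: "(W has_vector_derivative W') (at t)"
  shows "((\<lambda>s. B (X s) (W s)) has_real_derivative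
      frechet_derivative (\<lambda>y. B y (W t)) (at (X t)) X' + B (X t) W') (at t)"
proof -
  have B: "((\<lambda>q. B (fst q) (snd q)) has_derivative
     (\<lambda>h. frechet_derivative (\<lambda>y. B y (W t)) (at (X t)) (fst h) + B (X t) (snd h))) (at (X t, W t))"
    by (rule linear_family_has_derivative[OF S lin]) (use d in \<open>simp_all add: frechet_derivative_works\<close>)
  have "((\<lambda>s. (X s, W s)) has_vector_derivative (X', W')) (at t)"
    by (rule has_vector_derivative_Pair[OF X W])
  from has_vector_derivative_along_curve[OF this, of "\<lambda>q. B (fst q) (snd q)"]
  have "((\<lambda>s. B (X s) (W s)) has_vector_derivative
      frechet_derivative (\<lambda>q. B (fst q) (snd q)) (at (X t, W t)) (X', W')) (at t)"
    using B unfolding differentiable_def by auto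
  then show ?thesis
    by (simp add: has_real_derivative_iff_has_vector_derivative frechet_derivative_eqI[OF B])
qed

lemma bilinear_family_along_curve:
  fixes B :: "'a::real_normed_vector \<Rightarrow> 'e::euclidean_space \<Rightarrow> 'e \<Rightarrow> real"
  assumes S: "open S" "X t \<in> S" and bil: "\<And>y. y \<in> S \<Longrightarrow> bilinear (B y)"
    and d: "\<And>u v. (\<lambda>y. B y u v) differentiable (at (X t))"
    and X: "(X has_vector_derivative X') (at t)"
    and V: "(V has_vector_derivative V') (at t)" and W: "(W has_vector_derivative W') (at t)"
  shows "((\<lambda>s. B (X s) (V s) (W s)) has_real_derivative
      frechet_derivative (\<lambda>y. B y (V t) (W t)) (at (X t)) X' + B (X t) V' (W t) + B (X t) (V t) W') (at t)"
proof -
  have B: "((\<lambda>q. B (fst (fst q)) (snd (fst q)) (snd q)) has_derivative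
     (\<lambda>h. frechet_derivative (\<lambda>y. B y (V t) (W t)) (at (X t)) (fst (fst h))
        + B (X t) (snd (fst h)) (W t) + B (X t) (V t) (snd h))) (at ((X t, V t), W t))"
    by (rule bilinear_family_has_derivative[OF S bil]) (use d in \<open>simp_all add: frechet_derivative_works\<close>)
  have "((\<lambda>s. ((X s, V s), W s)) has_vector_derivative ((X', V'), W')) (at t)"
    by (intro has_vector_derivative_Pair X V W)
  from has_vector_derivative_along_curve[OF this, of "\<lambda>q. B (fst (fst q)) (snd (fst q)) (snd q)"]
  have "((\<lambda>s. B (X s) (V s) (W s)) has_vector_derivative
      frechet_derivative (\<lambda>q. B (fst (fst q)) (snd (fst q)) (snd q)) (at ((X t, V t), W t)) ((X', V'), W')) (at t)"
    using B unfolding differentiable_def by auto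
  then show ?thesis
    by (simp add: has_real_derivative_iff_has_vector_derivative frechet_derivative_eqI[OF B])
qed

lemma differentiable_linear_family:
  fixes B :: "'a::real_normed_vector \<Rightarrow> 'e::euclidean_space \<Rightarrow> real"
  assumes S: "open S" "x \<in> S" and lin: "\<And>y. y \<in> S \<Longrightarrow> linear (B y)"
    and d: "\<And>u. (\<lambda>y. B y u) differentiable (at x)" and W: "W differentiable (at x)"
  shows "(\<lambda>y. B y (W y)) differentiable (at x)"
proof -
  have B: "((\<lambda>q. B (fst q) (snd q)) has_derivative
     (\<lambda>h. frechet_derivative (\<lambda>y. B y (W x)) (at x) (fst h) + B x (snd h))) (at (x, W x))"
    by (rule linear_family_has_derivative[OF S lin]) (use d in \<open>simp_all add: frechet_derivative_works\<close>)
  obtain W' where "(W has_derivative W') (at x)" using W unfolding differentiable_def by blast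
  then have "((\<lambda>y. (y, W y)) has_derivative (\<lambda>h. (h, W' h))) (at x)"
    by (rule has_derivative_Pair[OF has_derivative_ident])
  from has_derivative_compose[OF this B] show ?thesis unfolding differentiable_def by auto
qed

lemma isCont_tendsto_nhds: "isCont g t \<Longrightarrow> (g \<longlongrightarrow> g t) (nhds t)"
  by (simp add: isCont_def tendsto_at_iff_tendsto_nhds)

lemma linear_family_isCont:
  fixes B :: "'a::real_normed_vector \<Rightarrow> 'e::euclidean_space \<Rightarrow> real"
  assumes S: "open S" "x \<in> S" and lin: "\<And>y. y \<in> S \<Longrightarrow> linear (B y)"
    and d: "\<And>u. (\<lambda>y. B y u) differentiable (at x)"
  shows "isCont (\<lambda>q. B (fst q) (snd q)) (x, w)"
proof -
  have "((\<lambda>q. B (fst q) (snd q)) has_derivative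
     (\<lambda>h. frechet_derivative (\<lambda>y. B y w) (at x) (fst h) + B x (snd h))) (at (x, w))"
    by (rule linear_family_has_derivative[OF S lin]) (use d in \<open>simp_all add: frechet_derivative_works\<close>)
  then show ?thesis by (rule has_derivative_continuous)
qed

lemma bilinear_family_isCont:
  fixes B :: "'a::real_normed_vector \<Rightarrow> 'e::euclidean_space \<Rightarrow> 'e \<Rightarrow> real"
  assumes S: "open S" "x \<in> S" and bil: "\<And>y. y \<in> S \<Longrightarrow> bilinear (B y)"
    and d: "\<And>u v. (\<lambda>y. B y u v) differentiable (at x)"
  shows "isCont (\<lambda>q. B (fst (fst q)) (snd (fst q)) (snd q)) ((x, a), w)"
proof -
  have "((\<lambda>q. B (fst (fst q)) (snd (fst q)) (snd q)) has_derivative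
     (\<lambda>h. frechet_derivative (\<lambda>y. B y a w) (at x) (fst (fst h))
        + B x (snd (fst h)) w + B x a (snd h))) (at ((x, a), w))"
    by (rule bilinear_family_has_derivative[OF S bil]) (use d in \<open>simp_all add: frechet_derivative_works\<close>)
  then show ?thesis by (rule has_derivative_continuous)
qed

section \<open>Differentiability of solutions of linear systems\<close>

text \<open>The factor \<open>z\<close> need only be continuous since the other one vanishes at \<open>x\<close>: replacing \<open>z y\<close> by \<open>z x\<close>
  changes the product by \<open>o(1) O(|y - x|)\<close>.\<close>

lemma has_derivative_continuous_times_vanishing:
  fixes z m :: "'a::real_normed_vector \<Rightarrow> real"
  assumes z: "isCont z x" and m: "(m has_derivative m') (at x)" and 0: "m x = 0"
  shows "((\<lambda>y. z y * m y) has_derivative (\<lambda>h. z x * m' h)) (at x)"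
proof -
  have bl: "bounded_linear m'" using m by (rule has_derivative_bounded_linear)
  have quot: "((\<lambda>y. (m y - m' (y - x)) / norm (y - x)) \<longlongrightarrow> 0) (at x)"
  proof (rule tendsto_norm_zero_cancel)
    have "((\<lambda>y. norm (m y - m x - m' (y - x)) / norm (y - x)) \<longlongrightarrow> 0) (at x)"
      using m unfolding has_derivative_iff_norm by blast
    then show "((\<lambda>y. norm ((m y - m' (y - x)) / norm (y - x))) \<longlongrightarrow> 0) (at x)"
      by (simp add: 0)
  qed
  obtain K where K: "\<And>h. norm (m' h) \<le> norm h * K"
    using bounded_linear.bounded[OF bl] by blast
  have zt: "((\<lambda>y. z y - z x) \<longlongrightarrow> 0) (at x)"
    using z unfolding isCont_def by (rule LIM_zero)
  have bdd: "((\<lambda>y. (z y - z x) * (m' (y - x) / norm (y - x))) \<longlongrightarrow> 0) (at x)"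
  proof (rule Lim_null_comparison)
    show "\<forall>\<^sub>F y in at x. norm ((z y - z x) * (m' (y - x) / norm (y - x))) \<le> \<bar>z y - z x\<bar> * \<bar>K\<bar>"
    proof (rule always_eventually, rule allI)
      fix y
      have "\<bar>m' (y - x)\<bar> \<le> norm (y - x) * \<bar>K\<bar>"
        using K[of "y - x"] by (smt (verit) mult_left_mono norm_ge_zero real_norm_def)
      then have "\<bar>m' (y - x) / norm (y - x)\<bar> \<le> \<bar>K\<bar>"
        by (cases "y = x") (auto simp: field_simps)
      then show "norm ((z y - z x) * (m' (y - x) / norm (y - x))) \<le> \<bar>z y - z x\<bar> * \<bar>K\<bar>"
        unfolding real_norm_def abs_mult by (rule mult_left_mono) simp
    qed
    show "((\<lambda>y. \<bar>z y - z x\<bar> * \<bar>K\<bar>) \<longlongrightarrow> 0) (at x)"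
      using tendsto_mult[OF tendsto_rabs_zero[OF zt] tendsto_const, of "\<bar>K\<bar>"] by simp
  qed
  have "((\<lambda>y. z y * ((m y - m' (y - x)) / norm (y - x)) + (z y - z x) * (m' (y - x) / norm (y - x))) \<longlongrightarrow> 0) (at x)"
    using tendsto_add[OF tendsto_mult[OF z[unfolded isCont_def] quot] bdd] by simp
  then have "((\<lambda>y. (z y * m y - z x * m x - z x * m' (y - x)) / norm (y - x)) \<longlongrightarrow> 0) (at x)"
    by (simp add: 0 field_simps add_divide_distrib diff_divide_distrib)
  then have "((\<lambda>y. norm (z y * m y - z x * m x - z x * m' (y - x)) / norm (y - x)) \<longlongrightarrow> 0) (at x)"
    using tendsto_norm_zero by fastforce
  then show ?thesis
    unfolding has_derivative_iff_norm using bl by (auto intro: bounded_linear_const_mult)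
qed

text \<open>Let \<open>R\<close> invert the operator of \<open>A x\<close>. Subtracting the equations at \<open>x\<close> and \<open>y\<close> gives
  \<open>z y = z x + R (k y - k x) - R ((A y - A x) (z y))\<close>. As \<open>A y - A x\<close> is small, this first shows that \<open>z\<close> is
  continuous at \<open>x\<close>. Then the last term is a product of a continuous function and a differentiable one
  that vanishes at \<open>x\<close>, so the right-hand side is differentiable.\<close>

lemma linear_solution_differentiable:
  fixes A :: "'a::real_normed_vector \<Rightarrow> 'e::euclidean_space \<Rightarrow> 'e \<Rightarrow> real"
  assumes S: "open S" "x \<in> S"
    and bil: "\<And>y. y \<in> S \<Longrightarrow> bilinear (A y)"
    and pos: "\<And>a. a \<noteq> 0 \<Longrightarrow> 0 < A x a a"
    and sol: "\<And>y b. y \<in> S \<Longrightarrow> A y (z y) b = k y b"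
    and dA: "\<And>a b. (\<lambda>y. A y a b) differentiable (at x)"
    and dk: "\<And>b. (\<lambda>y. k y b) differentiable (at x)"
  shows "z differentiable (at x)"
proof -
  define L where "L u = (\<Sum>b\<in>Basis. A x u b *\<^sub>R b)" for u
  note bx = bil[OF S(2)]
  have lin: "linear L"
    unfolding L_def
    by (rule linearI)
      (simp_all add: bilinear_ladd[OF bx] bilinear_lmul[OF bx] scaleR_add_left sum.distrib scaleR_sum_right)
  have "inj L"
  proof (rule linear_injective_0[THEN iffD2, rule_format, OF lin])
    fix u assume "L u = 0"
    then have 0: "A x u b = 0" if "b \<in> Basis" for b
      using inner_sum_left_Basis[OF that, of "A x u"] unfolding L_def by simp
    have "A x u u = (\<Sum>b\<in>Basis. (u \<bullet> b) * A x u b)"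
      using linear_eq_sum_Basis[OF bilinear_right[OF bx]] .
    also have "\<dots> = 0" using 0 by simp
    finally show "u = 0" using pos[of u] by force
  qed
  then obtain R where R: "linear R" "R \<circ> L = id"
    using linear_injective_left_inverse[OF lin] by blast
  have bR: "bounded_linear R" using R linear_conv_bounded_linear by blast
  define m where "m c b y = A y c b - A x c b" for c b y
  have repr: "z y = z x + R (\<Sum>b\<in>Basis. (k y b - k x b) *\<^sub>R b)
      - R (\<Sum>b\<in>Basis. (\<Sum>c\<in>Basis. (z y \<bullet> c) * m c b y) *\<^sub>R b)" if y: "y \<in> S" for y
  proof -
    have e: "A y' u b = (\<Sum>c\<in>Basis. (u \<bullet> c) * A y' c b)" if "y' \<in> S" for y' u b
      using linear_eq_sum_Basis[OF bilinear_left[OF bil[OF that]]] .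
    have "A x (z y - z x) b = (k y b - k x b) - (\<Sum>c\<in>Basis. (z y \<bullet> c) * m c b y)" for b
    proof -
      have "(\<Sum>c\<in>Basis. (z y \<bullet> c) * m c b y) = A y (z y) b - A x (z y) b"
        by (simp add: m_def e[OF y, of "z y"] e[OF S(2), of "z y"] right_diff_distrib sum_subtractf)
      then show ?thesis by (simp add: bilinear_lsub[OF bx] sol[OF y] sol[OF S(2)])
    qed
    then have "L (z y - z x) = (\<Sum>b\<in>Basis. (k y b - k x b) *\<^sub>R b)
       - (\<Sum>b\<in>Basis. (\<Sum>c\<in>Basis. (z y \<bullet> c) * m c b y) *\<^sub>R b)"
      by (simp add: L_def scaleR_diff_left sum_subtractf)
    then have "R (L (z y - z x)) = R (\<Sum>b\<in>Basis. (k y b - k x b) *\<^sub>R b)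
       - R (\<Sum>b\<in>Basis. (\<Sum>c\<in>Basis. (z y \<bullet> c) * m c b y) *\<^sub>R b)"
      using R by (simp add: linear_diff)
    then show ?thesis using R(2) by (simp add: o_def id_def fun_eq_iff algebra_simps)
  qed
  have dm: "m c b differentiable (at x)" for c b
    unfolding m_def using dA by simp
  have evS: "\<forall>\<^sub>F y in at x. y \<in> S" using S by (rule eventually_at_in_open')
  have cont: "isCont z x"
  proof -
    obtain C where C: "C > 0" "\<And>u. norm (R u) \<le> norm u * C"
      using bounded_linear.pos_bounded[OF bR] by blast
    define \<mu> where "\<mu> y = (\<Sum>b\<in>Basis. \<Sum>c\<in>Basis. \<bar>m c b y\<bar>)" for y
    define \<kappa> where "\<kappa> y = (\<Sum>b\<in>Basis. \<bar>k y b - k x b\<bar>)" for y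
    have mt: "(\<mu> \<longlongrightarrow> 0) (at x)"
    proof -
      have "isCont \<mu> x" unfolding \<mu>_def
        using differentiable_imp_continuous_within[OF dm] by (auto intro!: continuous_intros)
      then show ?thesis unfolding isCont_def by (simp add: \<mu>_def m_def)
    qed
    have kt: "(\<kappa> \<longlongrightarrow> 0) (at x)"
    proof -
      have "isCont \<kappa> x" unfolding \<kappa>_def
        using differentiable_imp_continuous_within[OF dk] by (auto intro!: continuous_intros)
      then show ?thesis unfolding isCont_def by (simp add: \<kappa>_def)
    qed
    have est: "norm (z y - z x) \<le> C * \<kappa> y + C * \<mu> y * norm (z y)" if y: "y \<in> S" for y
    proof -
      have "norm (\<Sum>b\<in>Basis. (\<Sum>c\<in>Basis. (z y \<bullet> c) * m c b y) *\<^sub>R b)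
        \<le> (\<Sum>b\<in>Basis. norm ((\<Sum>c\<in>Basis. (z y \<bullet> c) * m c b y) *\<^sub>R b))" by (rule norm_sum)
      also have "\<dots> \<le> (\<Sum>b\<in>Basis. \<Sum>c\<in>Basis. norm (z y) * \<bar>m c b y\<bar>)"
      proof (rule sum_mono)
        fix b :: 'e assume b: "b \<in> Basis"
        have "\<bar>\<Sum>c\<in>Basis. (z y \<bullet> c) * m c b y\<bar> \<le> (\<Sum>c\<in>Basis. norm (z y) * \<bar>m c b y\<bar>)"
          by (rule order_trans[OF sum_abs])
             (auto simp: abs_mult Basis_le_norm intro!: sum_mono mult_right_mono)
        then show "norm ((\<Sum>c\<in>Basis. (z y \<bullet> c) * m c b y) *\<^sub>R b) \<le> (\<Sum>c\<in>Basis. norm (z y) * \<bar>m c b y\<bar>)"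
          using b by simp
      qed
      also have "\<dots> = \<mu> y * norm (z y)" by (simp add: \<mu>_def sum_distrib_left mult.commute)
      finally have 1: "norm (R (\<Sum>b\<in>Basis. (\<Sum>c\<in>Basis. (z y \<bullet> c) * m c b y) *\<^sub>R b)) \<le> C * \<mu> y * norm (z y)"
        using C by (smt (verit) mult.assoc mult.commute mult_left_mono)
      have "norm (\<Sum>b\<in>Basis. (k y b - k x b) *\<^sub>R b) \<le> \<kappa> y"
        unfolding \<kappa>_def by (rule order_trans[OF norm_sum]) auto
      then have 2: "norm (R (\<Sum>b\<in>Basis. (k y b - k x b) *\<^sub>R b)) \<le> C * \<kappa> y"
        using C by (smt (verit) mult.commute mult_left_mono)
      have "z y - z x = R (\<Sum>b\<in>Basis. (k y b - k x b) *\<^sub>R b)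
         - R (\<Sum>b\<in>Basis. (\<Sum>c\<in>Basis. (z y \<bullet> c) * m c b y) *\<^sub>R b)"
      proof -
        have *: "a = b + p - q \<Longrightarrow> a - b = p - q" for a b p q :: 'e by simp
        show ?thesis using *[OF repr[OF y]] .
      qed
      then show ?thesis using 1 2 norm_triangle_ineq4 by (smt (verit))
    qed
    have "((\<lambda>y. C * \<mu> y) \<longlongrightarrow> 0) (at x)" using tendsto_mult_left[OF mt, of C] by simp
    \<comment> \<open>Bounding \<open>norm (z y)\<close> by \<open>norm (z x) + norm (z y - z x)\<close> in \<open>est\<close>, the second summand contributes at most
      half of the left-hand side and is absorbed by it.\<close>
    then have ev: "\<forall>\<^sub>F y in at x. C * \<mu> y < 1/2" by (rule order_tendstoD) simp
    have "((\<lambda>y. z y - z x) \<longlongrightarrow> 0) (at x)"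
    proof (rule Lim_null_comparison)
      show "\<forall>\<^sub>F y in at x. norm (z y - z x) \<le> 2 * (C * \<kappa> y + C * \<mu> y * norm (z x))"
        using ev evS
      proof eventually_elim
        case (elim y)
        have "0 \<le> \<mu> y" unfolding \<mu>_def by (intro sum_nonneg) auto
        then have "C * \<mu> y * norm (z y) \<le> C * \<mu> y * (norm (z x) + norm (z y - z x))"
          using C norm_triangle_sub[of "z y" "z x"] by (intro mult_left_mono) auto
        moreover have "C * \<mu> y * norm (z y - z x) \<le> 1/2 * norm (z y - z x)"
          using elim(1) by (intro mult_right_mono) auto
        ultimately show ?case using est[OF elim(2)] by (simp add: distrib_left)
      qed
      have "((\<lambda>y. 2 * (C * \<kappa> y + C * \<mu> y * norm (z x))) \<longlongrightarrow> 2 * (C * 0 + C * 0 * norm (z x))) (at x)"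
        by (intro tendsto_intros mt kt)
      then show "((\<lambda>y. 2 * (C * \<kappa> y + C * \<mu> y * norm (z x))) \<longlongrightarrow> 0) (at x)" by simp
    qed
    then show ?thesis unfolding isCont_def by (rule LIM_zero_cancel)
  qed
  have zm: "(\<lambda>y. (z y \<bullet> c) * m c b y) differentiable (at x)" for c b
  proof -
    obtain m' where "(m c b has_derivative m') (at x)" using dm[of c b] unfolding differentiable_def by blast
    moreover have "m c b x = 0" by (simp add: m_def)
    moreover have "isCont (\<lambda>y. z y \<bullet> c) x" using cont by (intro continuous_intros)
    ultimately have "((\<lambda>y. (z y \<bullet> c) * m c b y) has_derivative (\<lambda>h. (z x \<bullet> c) * m' h)) (at x)"
      using has_derivative_continuous_times_vanishing by blast
    then show ?thesis unfolding differentiable_def by blast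
  qed
  have R_diff: "(\<lambda>y. R (g y)) differentiable (at x)" if "g differentiable (at x)" for g :: "'a \<Rightarrow> 'e"
    using that bounded_linear.has_derivative[OF bR] unfolding differentiable_def by blast
  have "(\<lambda>y. z x + R (\<Sum>b\<in>Basis. (k y b - k x b) *\<^sub>R b)
      - R (\<Sum>b\<in>Basis. (\<Sum>c\<in>Basis. (z y \<bullet> c) * m c b y) *\<^sub>R b)) differentiable (at x)"
    by (intro differentiable_diff differentiable_add differentiable_const R_diff differentiable_sum
       differentiable_scaleR ballI zm dk finite_Basis)
  then obtain z' where "((\<lambda>y. z x + R (\<Sum>b\<in>Basis. (k y b - k x b) *\<^sub>R b)
      - R (\<Sum>b\<in>Basis. (\<Sum>c\<in>Basis. (z y \<bullet> c) * m c b y) *\<^sub>R b)) has_derivative z') (at x)"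
    unfolding differentiable_def by blast
  then have "(z has_derivative z') (at x)"
    by (rule has_derivative_transform_within_open[OF _ S]) (simp add: repr[symmetric])
  then show ?thesis unfolding differentiable_def by blast
qed

section \<open>Continuous induction and barriers\<close>

text \<open>A pointwise form of the tube lemma: \<open>P\<close> has to hold only near the slice over \<open>t\<close>.\<close>

lemma eventually_ball_compact:
  fixes K :: "'b::topological_space set" and t :: "'a::topological_space"
  assumes K: "compact K" and P: "\<And>w. w \<in> K \<Longrightarrow> eventually P (nhds (t, w))"
  shows "\<forall>\<^sub>F s in nhds t. \<forall>w\<in>K. P (s, w)"
proof -
  have "\<exists>U V. open U \<and> t \<in> U \<and> open V \<and> w \<in> V \<and> (\<forall>s\<in>U. \<forall>w'\<in>V. P (s, w'))" if w: "w \<in> K" for w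
  proof -
    obtain T where T: "open T" "(t, w) \<in> T" "\<forall>q\<in>T. P q"
      using P[OF w] unfolding eventually_nhds by blast
    then obtain U V where "open U" "open V" "(t, w) \<in> U \<times> V" "U \<times> V \<subseteq> T"
      using open_prod_elim by metis
    then have "open U \<and> t \<in> U \<and> open V \<and> w \<in> V \<and> (\<forall>s\<in>U. \<forall>w'\<in>V. P (s, w'))"
      using T(3) by blast
    then show ?thesis by blast
  qed
  then obtain U V where UV: "\<And>w. w \<in> K \<Longrightarrow> open (U w) \<and> t \<in> U w \<and> open (V w) \<and> w \<in> V w \<and>
     (\<forall>s\<in>U w. \<forall>w'\<in>V w. P (s, w'))" by metis
  obtain C where C: "C \<subseteq> K" "finite C" "K \<subseteq> (\<Union>w\<in>C. V w)"
    using compactE_image[OF K, of K V] UV by (metis UN_I subsetI)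
  have "\<forall>\<^sub>F s in nhds t. \<forall>w\<in>C. s \<in> U w"
    using C UV by (intro eventually_ball_finite ballI) (auto intro!: eventually_nhds_in_open)
  then show ?thesis
    by eventually_elim (use C UV in blast)
qed

text \<open>The infimum of the times at which \<open>Q\<close> fails satisfies \<open>Q\<close> by the second hypothesis, and cannot be such an
  infimum by the first one. The second hypothesis at \<open>t = 0\<close> is the base case.\<close>

lemma real_interval_induct:
  fixes Q :: "real \<Rightarrow> bool"
  assumes right: "\<And>t. 0 \<le> t \<Longrightarrow> t < 1 \<Longrightarrow> Q t \<Longrightarrow> eventually Q (at_right t)"
    and left: "\<And>t. 0 \<le> t \<Longrightarrow> t \<le> 1 \<Longrightarrow> (\<And>s. 0 \<le> s \<Longrightarrow> s < t \<Longrightarrow> Q s) \<Longrightarrow> Q t"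
    and t: "0 \<le> t" "t \<le> 1"
  shows "Q t"
proof (rule ccontr)
  assume nQ: "\<not> Q t"
  define S where "S = {s. 0 \<le> s \<and> s \<le> 1 \<and> \<not> Q s}"
  have tS: "t \<in> S" using nQ t by (simp add: S_def)
  have bdd: "bdd_below S" by (rule bdd_belowI[of _ 0]) (simp add: S_def)
  define T where "T = Inf S"
  have T0: "0 \<le> T" unfolding T_def using tS by (intro cInf_greatest) (auto simp: S_def)
  have Tt: "T \<le> t" unfolding T_def using tS bdd by (rule cInf_lower)
  have before: "Q s" if "0 \<le> s" "s < T" for s
  proof (rule ccontr)
    assume "\<not> Q s"
    then have "s \<in> S" using that Tt t by (simp add: S_def)
    then show False using cInf_lower[OF _ bdd, of s] that by (simp add: T_def)
  qed
  have QT: "Q T" using left[of T] T0 Tt t before by simp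
  then have "T \<noteq> t" using nQ by blast
  then have "T < 1" using Tt t by linarith
  then obtain b where b: "b > T" "\<And>s. T < s \<Longrightarrow> s < b \<Longrightarrow> Q s"
    using right[of T] QT T0 unfolding eventually_at_right_field by blast
  have "b \<le> s" if "s \<in> S" for s
    using that QT b(2)[of s] cInf_lower[OF that bdd] unfolding T_def S_def
    by (metis (mono_tags, lifting) linorder_not_less mem_Collect_eq order_le_less)
  then have "b \<le> T" unfolding T_def using tS by (intro cInf_greatest) auto
  then show False using b by simp
qed

text \<open>The contact step of the barrier arguments: since \<open>g\<close> decreases strictly at \<open>t\<close>, it is smaller there than
  at earlier times, where it is already negative.\<close>

lemma negative_derivative_imp_negative:
  fixes g :: "real \<Rightarrow> real"
  assumes d: "(g has_real_derivative g') (at t)" and "g' < 0"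
    and t: "0 < t" and neg: "\<forall>\<^sub>F s in at_left t. g s < 0"
  shows "g t < 0"
proof -
  obtain d where d: "d > 0" "\<And>h. h > 0 \<Longrightarrow> h < d \<Longrightarrow> g t < g (t - h)"
    using DERIV_neg_dec_left[OF assms(1,2)] by blast
  obtain b where b: "b < t" "\<And>s. b < s \<Longrightarrow> s < t \<Longrightarrow> g s < 0"
    using neg unfolding eventually_at_left_field by blast
  define h where "h = min (d / 2) ((t - b) / 2)"
  have "0 < h" "h < d" "b < t - h" using d(1) b(1) by (auto simp: h_def min_def field_simps)
  then show ?thesis using d(2)[of h] b(2)[of "t - h"] by simp
qed

section \<open>Charts and tangent vectors\<close>

locale riemannian_mfd =
  fixes M :: "('m::{t2_space, second_countable_topology}, 'e::euclidean_space) riemannian"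
  assumes riemannian: "riemannian_manifold M"
begin

lemma atlas_chart:
  assumes "c \<in> atlas M"
  shows "open (chart_dom c)" and "open (chart_img c)"
    and "homeomorphism (chart_dom c) (chart_img c) (coord c) (chart_inv c)"
  using assms riemannian unfolding riemannian_manifold_def smooth_atlas_def is_chart_def by blast+

lemma chart_inv_coord [simp]:
  "c \<in> charts_at M q \<Longrightarrow> chart_inv c (coord c q) = q"
  using atlas_chart(3) unfolding charts_at_def homeomorphism_def by blast

lemma coord_chart_inv:
  "c \<in> atlas M \<Longrightarrow> x \<in> chart_img c \<Longrightarrow> coord c (chart_inv c x) = x"
  using atlas_chart(3) unfolding homeomorphism_def by blast

lemma chart_at_in: "chart_at M q \<in> charts_at M q"
proof -
  have "\<exists>c. c \<in> charts_at M q"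
    using riemannian unfolding riemannian_manifold_def smooth_atlas_def charts_at_def by blast
  then show ?thesis unfolding chart_at_def by (rule someI_ex)
qed

lemma open_coord_image:
  assumes c: "c \<in> atlas M" and W: "open W"
  shows "open (coord c ` (chart_dom c \<inter> W))"
proof -
  have "openin (top_of_set (chart_img c)) (coord c ` (chart_dom c \<inter> W))"
    using homeomorphism_imp_open_map[OF atlas_chart(3)[OF c]] W by (simp add: openin_open_Int)
  then show ?thesis using atlas_chart(2)[OF c] openin_open_eq by blast
qed

lemma transition_smooth:
  "c \<in> atlas M \<Longrightarrow> c' \<in> atlas M \<Longrightarrow>
     smooth_on (coord c ` (chart_dom c \<inter> chart_dom c')) (transition c c')"
  using riemannian unfolding riemannian_manifold_def smooth_atlas_def by blast

lemma transition_differentiable: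
  assumes "c \<in> charts_at M q" "c' \<in> charts_at M q"
  shows "transition c c' differentiable (at (coord c q))"
  by (rule smooth_on_differentiable[OF transition_smooth]) (use assms in \<open>auto simp: charts_at_def\<close>)

lemma transition_coord [simp]:
  "c \<in> charts_at M q \<Longrightarrow> transition c c' (coord c q) = coord c' q"
  by (simp add: transition_def)

lemma linear_transition_derivative:
  assumes "c \<in> charts_at M q" "c' \<in> charts_at M q"
  shows "linear (frechet_derivative (transition c c') (at (coord c q)))"
  using transition_differentiable[OF assms] linear_frechet_derivative by blast

text \<open>A function of the manifold read in a chart is the same function read in another chart,
  composed with the transition map.\<close>

lemma frechet_derivative_change_chart:
  fixes G :: "'m \<Rightarrow> 'b::real_normed_vector"
  assumes c: "c \<in> charts_at M q" and c': "c' \<in> charts_at M q"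
    and G: "(G \<circ> chart_inv c') differentiable (at (coord c' q))"
  shows "frechet_derivative (G \<circ> chart_inv c) (at (coord c q)) a
    = frechet_derivative (G \<circ> chart_inv c') (at (coord c' q))
        (frechet_derivative (transition c c') (at (coord c q)) a)"
proof -
  define S where "S = coord c ` (chart_dom c \<inter> chart_dom c')"
  have S: "open S" "coord c q \<in> S"
    using c c' open_coord_image atlas_chart(1) unfolding S_def charts_at_def by auto
  have 1: "(transition c c' has_derivative frechet_derivative (transition c c') (at (coord c q))) (at (coord c q))"
    using transition_differentiable[OF c c'] by (simp only: frechet_derivative_works)
  have 2: "(G \<circ> chart_inv c' has_derivative frechet_derivative (G \<circ> chart_inv c') (at (coord c' q)))
      (at (transition c c' (coord c q)))"
    using G c unfolding frechet_derivative_works by simp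
  have "((\<lambda>y. (G \<circ> chart_inv c') (transition c c' y)) has_derivative
     (\<lambda>h. frechet_derivative (G \<circ> chart_inv c') (at (coord c' q))
        (frechet_derivative (transition c c') (at (coord c q)) h))) (at (coord c q))"
    using has_derivative_compose[OF 1 2] .
  then have "((G \<circ> chart_inv c) has_derivative
     (\<lambda>h. frechet_derivative (G \<circ> chart_inv c') (at (coord c' q))
        (frechet_derivative (transition c c') (at (coord c q)) h))) (at (coord c q))"
  proof (rule has_derivative_transform_within_open[OF _ S])
    fix y assume "y \<in> S"
    then obtain r where "r \<in> chart_dom c \<inter> chart_dom c'" "y = coord c r" unfolding S_def by blast
    then have "c \<in> charts_at M r" "c' \<in> charts_at M r" "y = coord c r"
      using c c' by (auto simp: charts_at_def)
    then show "(G \<circ> chart_inv c') (transition c c' y) = (G \<circ> chart_inv c) y" by simp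
  qed
  then show ?thesis by (rule frechet_derivative_eqI)
qed

lemma transition_derivative_cocycle:
  assumes c: "c \<in> charts_at M q" and c': "c' \<in> charts_at M q" and c'': "c'' \<in> charts_at M q"
  shows "frechet_derivative (transition c c'') (at (coord c q)) a
    = frechet_derivative (transition c' c'') (at (coord c' q))
        (frechet_derivative (transition c c') (at (coord c q)) a)"
  using frechet_derivative_change_chart[OF c c', of "coord c''"] transition_differentiable[OF c' c'']
  unfolding transition_def by blast

lemma transition_derivative_self:
  assumes c: "c \<in> charts_at M q"
  shows "frechet_derivative (transition c c) (at (coord c q)) a = a"
proof -
  have c': "c \<in> atlas M" using c by (simp add: charts_at_def)
  have "((\<lambda>x. x) has_derivative (\<lambda>x. x)) (at (coord c q))" by (rule has_derivative_ident)
  then have "(transition c c has_derivative (\<lambda>x. x)) (at (coord c q))"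
    by (rule has_derivative_transform_within_open[OF _ atlas_chart(2)[OF c']])
       (use c in \<open>auto simp: transition_def coord_chart_inv[OF c'] charts_at_def\<close>)
  then show ?thesis by (rule frechet_derivative_eqI)
qed

lemma tvec_of_apply: "c \<in> charts_at M q \<Longrightarrow> tvec_of M c q a c = a"
  by (simp add: tvec_of_def transition_derivative_self)

lemma tangent_space_change_chart:
  "v \<in> tangent_space M q \<Longrightarrow> c \<in> charts_at M q \<Longrightarrow> c' \<in> charts_at M q \<Longrightarrow>
     v c' = frechet_derivative (transition c c') (at (coord c q)) (v c)"
  unfolding tangent_space_def by blast

lemma tangent_space_zero: "v \<in> tangent_space M q \<Longrightarrow> c \<notin> charts_at M q \<Longrightarrow> v c = 0"
  unfolding tangent_space_def by blast

lemma tangent_spaceI: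
  assumes "\<And>c c'. c \<in> charts_at M q \<Longrightarrow> c' \<in> charts_at M q \<Longrightarrow>
      v c' = frechet_derivative (transition c c') (at (coord c q)) (v c)"
    and "\<And>c. c \<notin> charts_at M q \<Longrightarrow> v c = 0"
  shows "v \<in> tangent_space M q"
  using assms unfolding tangent_space_def by blast

lemma tvec_of_in_tangent_space:
  assumes c: "c \<in> charts_at M q"
  shows "tvec_of M c q a \<in> tangent_space M q"
proof (rule tangent_spaceI)
  fix c' c'' assume c': "c' \<in> charts_at M q" and c'': "c'' \<in> charts_at M q"
  show "tvec_of M c q a c'' =
      frechet_derivative (transition c' c'') (at (coord c' q)) (tvec_of M c q a c')"
    unfolding tvec_of_def if_P[OF c'] if_P[OF c''] by (rule transition_derivative_cocycle[OF c c' c''])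
qed (simp add: tvec_of_def)

lemma tvec_of_coords:
  assumes c: "c \<in> charts_at M q" and v: "v \<in> tangent_space M q"
  shows "tvec_of M c q (v c) = v"
proof
  fix c'
  show "tvec_of M c q (v c) c' = v c'"
  proof (cases "c' \<in> charts_at M q")
    case True
    then show ?thesis using tangent_space_change_chart[OF v c True] by (simp add: tvec_of_def)
  next
    case False
    then show ?thesis using tangent_space_zero[OF v] by (simp add: tvec_of_def)
  qed
qed

lemma tangent_vector_nonzero:
  assumes "c \<in> charts_at M q" "v \<in> tangent_space M q" "v \<noteq> (\<lambda>_. 0)"
  shows "v c \<noteq> 0"
proof
  assume 0: "v c = 0"
  have "v c' = 0" for c'
  proof (cases "c' \<in> charts_at M q")
    case True
    then show ?thesis
      using tangent_space_change_chart[OF assms(2,1)] linear_transition_derivative[OF assms(1)] 0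
      by (simp add: linear_0)
  next
    case False
    then show ?thesis using tangent_space_zero[OF assms(2)] by simp
  qed
  then show False using assms(3) by auto
qed

section \<open>The Levi-Civita connection in a chart\<close>

context
  fixes c :: "('m, 'e) chart" and x :: 'e
  assumes c: "c \<in> atlas M" and x: "x \<in> chart_img c"
begin

lemma metric_bilinear: "bilinear (metric_coeff M c x)"
  and metric_commute: "metric_coeff M c x a b = metric_coeff M c x b a"
  and metric_positive: "a \<noteq> 0 \<Longrightarrow> 0 < metric_coeff M c x a a"
  using riemannian c x unfolding riemannian_manifold_def by blast+

end

lemma metric_smooth:
  "c \<in> atlas M \<Longrightarrow> smooth_on (chart_img c) (\<lambda>x. metric_coeff M c x a b)"
  using riemannian unfolding riemannian_manifold_def by blast

definition metric_deriv :: "('m, 'e) chart \<Rightarrow> 'e \<Rightarrow> 'e \<Rightarrow> 'e \<Rightarrow> 'e \<Rightarrow> real" where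
  "metric_deriv c x u a b = frechet_derivative (\<lambda>y. metric_coeff M c y a b) (at x) u"

text \<open>The Koszul formula for fields with constant coefficients, whose Lie brackets vanish.\<close>

definition koszul :: "('m, 'e) chart \<Rightarrow> 'e \<Rightarrow> 'e \<Rightarrow> 'e \<Rightarrow> 'e \<Rightarrow> real" where
  "koszul c x u a b =
     (metric_deriv c x u a b + metric_deriv c x a u b - metric_deriv c x b u a) / 2"

definition is_levi_civita :: "('m, 'e) chart \<Rightarrow> 'e \<Rightarrow> ('e \<Rightarrow> 'e \<Rightarrow> 'e) \<Rightarrow> bool" where
  "is_levi_civita c x \<Gamma> \<longleftrightarrow> bilinear \<Gamma> \<and> (\<forall>a b. \<Gamma> a b = \<Gamma> b a) \<and>
     (\<forall>u a b. metric_deriv c x u a b =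
        metric_coeff M c x (\<Gamma> u a) b + metric_coeff M c x a (\<Gamma> u b))"

context
  fixes c :: "('m, 'e) chart" and x :: 'e
  assumes c: "c \<in> atlas M" and x: "x \<in> chart_img c"
begin

lemma metric_deriv_linear:
  "linear (\<lambda>u. metric_deriv c x u a b)" "linear (\<lambda>a. metric_deriv c x u a b)"
  "linear (\<lambda>b. metric_deriv c x u a b)"
proof -
  have d: "(\<lambda>y. metric_coeff M c y a b) differentiable (at x)" for a b
    using smooth_on_differentiable[OF metric_smooth[OF c] x] .
  show "linear (\<lambda>u. metric_deriv c x u a b)"
    unfolding metric_deriv_def using d by (rule linear_frechet_derivative)
  show "linear (\<lambda>a. metric_deriv c x u a b)" unfolding metric_deriv_def
    by (rule frechet_derivative_linear_family[OF atlas_chart(2)[OF c] x, where B = "\<lambda>y a. metric_coeff M c y a b"])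
       (use metric_bilinear[OF c] bilinear_left d in blast)+
  show "linear (\<lambda>b. metric_deriv c x u a b)" unfolding metric_deriv_def
    by (rule frechet_derivative_linear_family[OF atlas_chart(2)[OF c] x, where B = "\<lambda>y b. metric_coeff M c y a b"])
       (use metric_bilinear[OF c] bilinear_right d in blast)+
qed

lemma metric_deriv_commute: "metric_deriv c x u a b = metric_deriv c x u b a"
proof -
  have d: "((\<lambda>y. metric_coeff M c y a b) has_derivative frechet_derivative (\<lambda>y. metric_coeff M c y a b) (at x)) (at x)"
    using smooth_on_differentiable[OF metric_smooth[OF c] x] unfolding frechet_derivative_works .
  then have "((\<lambda>y. metric_coeff M c y b a) has_derivative frechet_derivative (\<lambda>y. metric_coeff M c y a b) (at x)) (at x)"
    by (rule has_derivative_transform_within_open[OF _ atlas_chart(2)[OF c] x]) (rule metric_commute[OF c])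
  then show ?thesis unfolding metric_deriv_def by (rule frechet_derivative_eqI[symmetric])
qed

text \<open>In the Koszul combination of the three metric derivatives all terms except the two equal ones
  \<open>g(\<Gamma>(u, a), b)\<close> cancel, by symmetry of \<open>\<Gamma>\<close>. So the connection is unique.\<close>

lemma levi_civita_koszul:
  assumes "is_levi_civita c x \<Gamma>"
  shows "metric_coeff M c x (\<Gamma> u a) b = koszul c x u a b"
proof -
  have s: "\<Gamma> a b = \<Gamma> b a" for a b using assms unfolding is_levi_civita_def by blast
  have m: "metric_deriv c x u a b = metric_coeff M c x (\<Gamma> u a) b + metric_coeff M c x a (\<Gamma> u b)" for u a b
    using assms unfolding is_levi_civita_def by blast
  show ?thesis
    unfolding koszul_def m s[of a u] s[of b u] s[of b a] metric_commute[OF c x, of a "\<Gamma> u b"] by simp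
qed

lemma metric_nondegenerate:
  assumes "\<And>b. metric_coeff M c x a b = metric_coeff M c x a' b"
  shows "a = a'"
proof (rule ccontr)
  assume "a \<noteq> a'"
  then have "0 < metric_coeff M c x (a - a') (a - a')" using metric_positive[OF c x] by simp
  then show False using assms[of "a - a'"] bilinear_lsub[OF metric_bilinear[OF c x]] by simp
qed

lemma levi_civita_exists: "\<exists>\<Gamma>. is_levi_civita c x \<Gamma>"
proof -
  note g = metric_bilinear[OF c x]
  have lk: "linear (koszul c x u a)" "linear (\<lambda>u. koszul c x u a b)" for u a b
    unfolding koszul_def
    by (rule linearI; simp add: linear_add[OF metric_deriv_linear(1)] linear_add[OF metric_deriv_linear(2)]
      linear_add[OF metric_deriv_linear(3)] linear_cmul[OF metric_deriv_linear(1)]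
      linear_cmul[OF metric_deriv_linear(2)] linear_cmul[OF metric_deriv_linear(3)] algebra_simps diff_divide_distrib add_divide_distrib)+
  have ks: "koszul c x u a b = koszul c x a u b" for u a b
    unfolding koszul_def using metric_deriv_commute[of b a u] by simp
  have "\<exists>\<Gamma>. \<forall>u a b. metric_coeff M c x (\<Gamma> u a) b = koszul c x u a b"
    using positive_definite_solvable[OF g metric_positive[OF c x] lk(1)] by metis
  then obtain \<Gamma> where \<Gamma>: "\<And>u a b. metric_coeff M c x (\<Gamma> u a) b = koszul c x u a b" by blast
  have sym: "\<Gamma> u a = \<Gamma> a u" for u a
    by (rule metric_nondegenerate) (simp add: \<Gamma> ks[of u])
  have left: "linear (\<lambda>u. \<Gamma> u a)" for a
    by (rule linearI; rule metric_nondegenerate)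
       (simp_all add: \<Gamma> bilinear_ladd[OF g] bilinear_lmul[OF g] linear_add[OF lk(2)] linear_cmul[OF lk(2)])
  then have "linear (\<Gamma> a)" for a using sym[of a] by (metis (no_types, lifting) ext)
  then have "bilinear \<Gamma>" using left by (simp add: bilinear_def)
  moreover have "metric_deriv c x u a b = metric_coeff M c x (\<Gamma> u a) b + metric_coeff M c x a (\<Gamma> u b)" for u a b
    unfolding metric_commute[OF c x, of a "\<Gamma> u b"] \<Gamma> koszul_def
    using metric_deriv_commute[of u a b] metric_deriv_commute[of a b u] metric_deriv_commute[of b a u] by argo
  ultimately show ?thesis using sym unfolding is_levi_civita_def by blast
qed

lemma christoffel_is_levi_civita: "is_levi_civita c x (christoffel M c x)"
proof -
  have "christoffel M c x = (THE \<Gamma>. is_levi_civita c x \<Gamma>)"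
    unfolding christoffel_def is_levi_civita_def metric_deriv_def ..
  moreover have "\<exists>!\<Gamma>. is_levi_civita c x \<Gamma>"
  proof (rule ex_ex1I[OF levi_civita_exists])
    fix \<Gamma> \<Gamma>' assume "is_levi_civita c x \<Gamma>" "is_levi_civita c x \<Gamma>'"
    then have "\<Gamma> u a = \<Gamma>' u a" for u a
      by (intro metric_nondegenerate) (simp add: levi_civita_koszul)
    then show "\<Gamma> = \<Gamma>'" by blast
  qed
  ultimately show ?thesis by (metis theI')
qed

lemma christoffel_bilinear: "bilinear (christoffel M c x)"
  and christoffel_commute: "christoffel M c x a b = christoffel M c x b a"
  and christoffel_koszul: "metric_coeff M c x (christoffel M c x u a) b = koszul c x u a b"
  using christoffel_is_levi_civita levi_civita_koszul unfolding is_levi_civita_def by blast+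

end

lemma christoffel_differentiable:
  assumes c: "c \<in> atlas M" and x: "x \<in> chart_img c"
  shows "(\<lambda>y. christoffel M c y u a) differentiable (at x)"
proof (rule linear_solution_differentiable[where A = "metric_coeff M c" and S = "chart_img c"
      and k = "\<lambda>y. koszul c y u a"])
  show "(\<lambda>y. metric_coeff M c y a b) differentiable (at x)" for a b
    using smooth_on_differentiable[OF metric_smooth[OF c] x] .
  have "(\<lambda>y. metric_deriv c y u a b) differentiable (at x)" for u a b
    unfolding metric_deriv_def
    using smooth_on_differentiable[OF smooth_on_frechet_derivative[OF metric_smooth[OF c]] x] .
  then show "(\<lambda>y. koszul c y u a b) differentiable (at x)" for b
    unfolding koszul_def by (intro differentiable_divide differentiable_diff differentiable_add differentiable_const) auto
qed (use atlas_chart(2)[OF c] x metric_bilinear[OF c] metric_positive[OF c x] christoffel_koszul[OF c] in auto)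

end

section \<open>Geodesics\<close>

context riemannian_mfd
begin

lemma geodesic_isCont: "geodesic_on M UNIV \<gamma> \<Longrightarrow> isCont \<gamma> t"
  by (simp add: geodesic_on_def continuous_on_eq_continuous_at)

lemma geodesic_eventually_in:
  assumes "geodesic_on M UNIV \<gamma>" "open S" "\<gamma> t \<in> S"
  shows "\<forall>\<^sub>F s in nhds t. \<gamma> s \<in> S"
proof -
  have "(\<gamma> \<longlongrightarrow> \<gamma> t) (nhds t)"
    using geodesic_isCont[OF assms(1)] by (simp add: isCont_def tendsto_at_iff_tendsto_nhds)
  then show ?thesis using assms(2,3) by (rule topological_tendstoD)
qed

lemma geodesic_eventually_chart:
  assumes "geodesic_on M UNIV \<gamma>" "c \<in> charts_at M (\<gamma> t)"
  shows "\<forall>\<^sub>F s in nhds t. c \<in> charts_at M (\<gamma> s)"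
  using geodesic_eventually_in[OF assms(1) atlas_chart(1), of c t] assms(2)
  by (auto simp: charts_at_def)

lemma geodesic_velocity:
  assumes \<gamma>: "geodesic_on M UNIV \<gamma>" and c: "c \<in> charts_at M (\<gamma> t)"
  shows "((\<lambda>s. coord c (\<gamma> s)) has_vector_derivative velocity M \<gamma> t c) (at t)"
    and "((\<lambda>s. velocity M \<gamma> s c) has_vector_derivative
      - christoffel M c (coord c (\<gamma> t)) (velocity M \<gamma> t c) (velocity M \<gamma> t c)) (at t)"
proof -
  have "c \<in> atlas M" using c by (simp add: charts_at_def)
  then obtain v where v: "\<And>s. \<gamma> s \<in> chart_dom c \<Longrightarrow>
        ((coord c \<circ> \<gamma>) has_vector_derivative v s) (at s) \<and>
        (v has_vector_derivative - christoffel M c (coord c (\<gamma> s)) (v s) (v s)) (at s)"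
    using \<gamma> unfolding geodesic_on_def by auto
  have veq: "velocity M \<gamma> s c = v s" if "c \<in> charts_at M (\<gamma> s)" for s
    using v[of s] that by (auto simp: velocity_def charts_at_def vector_derivative_at)
  have t: "\<gamma> t \<in> chart_dom c" using c by (simp add: charts_at_def)
  show "((\<lambda>s. coord c (\<gamma> s)) has_vector_derivative velocity M \<gamma> t c) (at t)"
    using v[OF t] veq[OF c] by (simp add: o_def)
  have "\<forall>\<^sub>F s in nhds t. velocity M \<gamma> s c = v s"
    using geodesic_eventually_chart[OF \<gamma> c] by eventually_elim (rule veq)
  then have "\<forall>\<^sub>F s in nhds t. v s = velocity M \<gamma> s c" by eventually_elim simp
  then show "((\<lambda>s. velocity M \<gamma> s c) has_vector_derivative
      - christoffel M c (coord c (\<gamma> t)) (velocity M \<gamma> t c) (velocity M \<gamma> t c)) (at t)"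
    using v[OF t] unfolding veq[OF c] by (blast intro: has_vector_derivative_cong_nhds)
qed

text \<open>The transformation law is the chain rule for \<open>coord c' \<circ> \<gamma> = transition c c' \<circ> (coord c \<circ> \<gamma>)\<close>.\<close>

lemma velocity_in_tangent_space:
  assumes \<gamma>: "geodesic_on M UNIV \<gamma>"
  shows "velocity M \<gamma> t \<in> tangent_space M (\<gamma> t)"
proof (rule tangent_spaceI)
  fix c c' assume c: "c \<in> charts_at M (\<gamma> t)" and c': "c' \<in> charts_at M (\<gamma> t)"
  have "((\<lambda>s. transition c c' (coord c (\<gamma> s))) has_vector_derivative
     frechet_derivative (transition c c') (at (coord c (\<gamma> t))) (velocity M \<gamma> t c)) (at t)"
    by (rule has_vector_derivative_along_curve[OF geodesic_velocity(1)[OF \<gamma> c] transition_differentiable[OF c c']])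
  moreover have "\<forall>\<^sub>F s in nhds t. transition c c' (coord c (\<gamma> s)) = coord c' (\<gamma> s)"
    using geodesic_eventually_chart[OF \<gamma> c] by eventually_elim simp
  ultimately have "((\<lambda>s. coord c' (\<gamma> s)) has_vector_derivative
     frechet_derivative (transition c c') (at (coord c (\<gamma> t))) (velocity M \<gamma> t c)) (at t)"
    by (rule has_vector_derivative_cong_nhds)
  then show "velocity M \<gamma> t c' =
      frechet_derivative (transition c c') (at (coord c (\<gamma> t))) (velocity M \<gamma> t c)"
    using geodesic_velocity(1)[OF \<gamma> c'] vector_derivative_unique_at by blast
qed (simp add: velocity_def)

end

section \<open>The covariant derivatives of a function in a chart\<close>

locale smooth_function_mfd = riemannian_mfd M
  for M :: "('m::{t2_space, second_countable_topology}, 'e::euclidean_space) riemannian" +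
  fixes D :: "'m set" and f :: "'m \<Rightarrow> real"
  assumes complete: "geodesically_complete M"
    and open_D: "open D" and smooth_f: "smooth_function_on M D f"
begin

definition dom_in :: "('m, 'e) chart \<Rightarrow> 'e set" where
  "dom_in c = coord c ` (chart_dom c \<inter> D)"

text \<open>Expressions of the differential, the Hessian and the third covariant derivative in one fixed chart. The
  operators they describe use at each point the chart chosen there, which may jump from point to point and
  cannot be differentiated directly.\<close>

definition diff_in :: "('m, 'e) chart \<Rightarrow> 'e \<Rightarrow> 'e \<Rightarrow> real" where
  "diff_in c x a = frechet_derivative (f \<circ> chart_inv c) (at x) a"

definition hess_in :: "('m, 'e) chart \<Rightarrow> 'e \<Rightarrow> 'e \<Rightarrow> 'e \<Rightarrow> real" where
  "hess_in c x a b = frechet_derivative (\<lambda>y. diff_in c y b) (at x) a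
     - diff_in c x (christoffel M c x a b)"

definition third_in :: "('m, 'e) chart \<Rightarrow> 'e \<Rightarrow> 'e \<Rightarrow> 'e \<Rightarrow> 'e \<Rightarrow> real" where
  "third_in c x u a b = frechet_derivative (\<lambda>y. hess_in c y a b) (at x) u
     - hess_in c x (christoffel M c x u a) b - hess_in c x a (christoffel M c x u b)"

lemma open_dom_in: "c \<in> atlas M \<Longrightarrow> open (dom_in c)"
  unfolding dom_in_def using open_coord_image open_D by blast

lemma coord_in_dom_in: "c \<in> charts_at M q \<Longrightarrow> q \<in> D \<Longrightarrow> coord c q \<in> dom_in c"
  unfolding dom_in_def charts_at_def by blast

lemma dom_inE:
  assumes "y \<in> dom_in c" "c \<in> atlas M"
  obtains q where "q \<in> D" "c \<in> charts_at M q" "y = coord c q"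
  using assms unfolding dom_in_def charts_at_def by blast

lemma dom_in_subset: "dom_in c \<subseteq> chart_img c"
  unfolding dom_in_def by blast

lemma f_chart_smooth: "c \<in> atlas M \<Longrightarrow> smooth_on (dom_in c) (f \<circ> chart_inv c)"
  using smooth_f unfolding smooth_function_on_def dom_in_def by blast

context
  fixes c :: "('m, 'e) chart" and x :: 'e
  assumes c: "c \<in> atlas M" and x: "x \<in> dom_in c"
begin

lemma dom_in_imp_chart_img: "x \<in> chart_img c" using x dom_in_subset by blast

lemma diff_in_linear: "linear (diff_in c x)"
  unfolding diff_in_def
  using linear_frechet_derivative[OF smooth_on_differentiable[OF f_chart_smooth[OF c] x]] by simp

lemma diff_in_differentiable: "(\<lambda>y. diff_in c y a) differentiable (at x)"
  unfolding diff_in_def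
  using smooth_on_differentiable[OF smooth_on_frechet_derivative[OF f_chart_smooth[OF c]] x] .

lemma hess_in_commute: "hess_in c x a b = hess_in c x b a"
  unfolding hess_in_def
  using symmetric_second_derivative[OF open_dom_in[OF c] x f_chart_smooth[OF c], of a b]
  by (simp add: diff_in_def christoffel_commute[OF c dom_in_imp_chart_img, of a b])

end

lemma hess_in_bilinear:
  assumes c: "c \<in> atlas M" and x: "x \<in> dom_in c"
  shows "bilinear (hess_in c x)"
proof -
  note \<Gamma> = christoffel_bilinear[OF c dom_in_imp_chart_img[OF c x]]
  have l: "linear (\<lambda>a. hess_in c x a b)" for b
  proof -
    have "linear (\<lambda>a. frechet_derivative (\<lambda>y. diff_in c y b) (at x) a)"
      using linear_frechet_derivative[OF diff_in_differentiable[OF c x]] .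
    moreover have "linear (\<lambda>a. diff_in c x (christoffel M c x a b))"
      using linear_compose[OF bilinear_left[OF \<Gamma>] diff_in_linear[OF c x]] by (simp add: o_def)
    ultimately show ?thesis unfolding hess_in_def by (rule linear_compose_sub)
  qed
  have "(\<lambda>b. hess_in c x a b) = (\<lambda>b. hess_in c x b a)" for a
    using hess_in_commute[OF c x] by blast
  then show ?thesis using l unfolding bilinear_def by metis
qed

lemma hess_in_differentiable:
  assumes c: "c \<in> atlas M" and x: "x \<in> dom_in c"
  shows "(\<lambda>y. hess_in c y a b) differentiable (at x)"
proof -
  have "(\<lambda>y. frechet_derivative (\<lambda>y. diff_in c y b) (at y) a) differentiable (at x)"
    unfolding diff_in_def
    using smooth_on_differentiable[OF smooth_on_frechet_derivative[OF
        smooth_on_frechet_derivative[OF f_chart_smooth[OF c]]] x] .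
  moreover have "(\<lambda>y. diff_in c y (christoffel M c y a b)) differentiable (at x)"
    by (rule differentiable_linear_family[OF open_dom_in[OF c] x])
       (use diff_in_linear[OF c] diff_in_differentiable[OF c x] christoffel_differentiable[OF c dom_in_imp_chart_img[OF c x]] in auto)
  ultimately show ?thesis unfolding hess_in_def by (rule differentiable_diff)
qed

lemma diff_in_along_curve:
  assumes c: "c \<in> atlas M" and x: "X t \<in> dom_in c"
    and X: "(X has_vector_derivative v) (at t)"
    and W: "(W has_vector_derivative - christoffel M c (X t) v (W t)) (at t)"
  shows "((\<lambda>s. diff_in c (X s) (W s)) has_real_derivative hess_in c (X t) v (W t)) (at t)"
proof -
  have "((\<lambda>s. diff_in c (X s) (W s)) has_real_derivative
     frechet_derivative (\<lambda>y. diff_in c y (W t)) (at (X t)) v + diff_in c (X t) (- christoffel M c (X t) v (W t))) (at t)"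
    by (rule linear_family_along_curve[OF open_dom_in[OF c] x _ _ X W])
       (use diff_in_linear[OF c] diff_in_differentiable[OF c x] in auto)
  then show ?thesis using diff_in_linear[OF c x] by (simp add: hess_in_def linear_neg)
qed

lemma hess_in_along_curve:
  assumes c: "c \<in> atlas M" and x: "X t \<in> dom_in c"
    and X: "(X has_vector_derivative v) (at t)"
    and V: "(V has_vector_derivative - christoffel M c (X t) v (V t)) (at t)"
    and W: "(W has_vector_derivative - christoffel M c (X t) v (W t)) (at t)"
  shows "((\<lambda>s. hess_in c (X s) (V s) (W s)) has_real_derivative third_in c (X t) v (V t) (W t)) (at t)"
proof -
  have "((\<lambda>s. hess_in c (X s) (V s) (W s)) has_real_derivative
     frechet_derivative (\<lambda>y. hess_in c y (V t) (W t)) (at (X t)) v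
     + hess_in c (X t) (- christoffel M c (X t) v (V t)) (W t)
     + hess_in c (X t) (V t) (- christoffel M c (X t) v (W t))) (at t)"
    by (rule bilinear_family_along_curve[OF open_dom_in[OF c] x _ _ X V W])
       (use hess_in_bilinear[OF c] hess_in_differentiable[OF c x] in auto)
  then show ?thesis
    using hess_in_bilinear[OF c x] by (simp add: third_in_def bilinear_lneg bilinear_rneg)
qed

lemma differential_in_chart:
  assumes q: "q \<in> D" and c: "c \<in> charts_at M q" and v: "v \<in> tangent_space M q"
  shows "differential M f q v = diff_in c (coord c q) (v c)"
proof -
  define c0 where "c0 = chart_at M q"
  have c0: "c0 \<in> charts_at M q" unfolding c0_def by (rule chart_at_in)
  have "(f \<circ> chart_inv c) differentiable (at (coord c q))"
    using smooth_on_differentiable[OF f_chart_smooth coord_in_dom_in[OF c q]] c by (simp add: charts_at_def)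
  from frechet_derivative_change_chart[OF c0 c this]
  show ?thesis
    by (simp add: differential_def Let_def c0_def[symmetric] diff_in_def tangent_space_change_chart[OF v c0 c])
qed

text \<open>The Hessian on the diagonal is the second derivative of the function along a geodesic, in
  which no chart occurs.\<close>

lemma geodesic_second_derivative_in_chart:
  assumes \<gamma>: "geodesic_on M UNIV \<gamma>" and c: "c \<in> charts_at M (\<gamma> t)" and D: "\<gamma> t \<in> D"
  shows "(deriv (f \<circ> \<gamma>) has_real_derivative
     hess_in c (coord c (\<gamma> t)) (velocity M \<gamma> t c) (velocity M \<gamma> t c)) (at t)"
proof -
  have ca: "c \<in> atlas M" using c by (simp add: charts_at_def)
  have first: "deriv (f \<circ> \<gamma>) s = diff_in c (coord c (\<gamma> s)) (velocity M \<gamma> s c)"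
    if cs: "c \<in> charts_at M (\<gamma> s)" and Ds: "\<gamma> s \<in> D" for s
  proof -
    have "((\<lambda>r. (f \<circ> chart_inv c) (coord c (\<gamma> r))) has_vector_derivative
       diff_in c (coord c (\<gamma> s)) (velocity M \<gamma> s c)) (at s)"
      unfolding diff_in_def
      by (rule has_vector_derivative_along_curve[OF geodesic_velocity(1)[OF \<gamma> cs]])
         (rule smooth_on_differentiable[OF f_chart_smooth[OF ca] coord_in_dom_in[OF cs Ds]])
    moreover have "\<forall>\<^sub>F r in nhds s. (f \<circ> chart_inv c) (coord c (\<gamma> r)) = (f \<circ> \<gamma>) r"
      using geodesic_eventually_chart[OF \<gamma> cs] by eventually_elim simp
    ultimately have "((f \<circ> \<gamma>) has_real_derivative diff_in c (coord c (\<gamma> s)) (velocity M \<gamma> s c)) (at s)"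
      unfolding has_real_derivative_iff_has_vector_derivative[symmetric]
      by (rule has_real_derivative_cong_nhds)
    then show ?thesis by (rule DERIV_imp_deriv)
  qed
  have "((\<lambda>s. diff_in c (coord c (\<gamma> s)) (velocity M \<gamma> s c)) has_real_derivative
     hess_in c (coord c (\<gamma> t)) (velocity M \<gamma> t c) (velocity M \<gamma> t c)) (at t)"
    by (rule diff_in_along_curve[OF ca coord_in_dom_in[OF c D] geodesic_velocity[OF \<gamma> c]])
  moreover have "\<forall>\<^sub>F s in nhds t. diff_in c (coord c (\<gamma> s)) (velocity M \<gamma> s c) = deriv (f \<circ> \<gamma>) s"
    using geodesic_eventually_chart[OF \<gamma> c] geodesic_eventually_in[OF \<gamma> open_D D]
    by eventually_elim (simp add: first)
  ultimately show ?thesis by (rule has_real_derivative_cong_nhds)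
qed

text \<open>By completeness every tangent vector is the velocity of a geodesic, so on the diagonal both sides are the
  same second derivative along a geodesic. Polarization does the rest.\<close>

lemma hess_in_change_chart:
  assumes q: "q \<in> D" and c: "c \<in> charts_at M q" and c': "c' \<in> charts_at M q"
    and u: "u \<in> tangent_space M q" and v: "v \<in> tangent_space M q"
  shows "hess_in c (coord c q) (u c) (v c) = hess_in c' (coord c' q) (u c') (v c')"
proof -
  have diag: "hess_in c (coord c q) (w c) (w c) = hess_in c' (coord c' q) (w c') (w c')"
    if w: "w \<in> tangent_space M q" for w
  proof -
    obtain \<gamma> where "geodesic_from M q w \<gamma>"
      using complete w unfolding geodesically_complete_def by blast
    then have \<gamma>: "geodesic_on M UNIV \<gamma>" "\<gamma> 0 = q" "velocity M \<gamma> 0 = w"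
      unfolding geodesic_from_def by auto
    show ?thesis
      using DERIV_unique[OF geodesic_second_derivative_in_chart[OF \<gamma>(1), of c 0]
         geodesic_second_derivative_in_chart[OF \<gamma>(1), of c' 0]] c c' q \<gamma> by simp
  qed
  define w where "w = tvec_of M c q (u c + v c)"
  have w: "w \<in> tangent_space M q" unfolding w_def by (rule tvec_of_in_tangent_space[OF c])
  have wc: "w c = u c + v c" unfolding w_def by (rule tvec_of_apply[OF c])
  have wc': "w c' = u c' + v c'"
    unfolding tangent_space_change_chart[OF w c c'] tangent_space_change_chart[OF u c c']
      tangent_space_change_chart[OF v c c'] wc
    using linear_transition_derivative[OF c c'] by (simp add: linear_add)
  have polar: "hess_in k (coord k q) a b = (hess_in k (coord k q) (a + b) (a + b)
     - hess_in k (coord k q) a a - hess_in k (coord k q) b b) / 2" if k: "k \<in> charts_at M q" for k a b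
  proof -
    have ka: "k \<in> atlas M" using k by (simp add: charts_at_def)
    note kx = coord_in_dom_in[OF k q]
    show ?thesis using hess_in_bilinear[OF ka kx] hess_in_commute[OF ka kx, of b a]
      by (simp add: bilinear_ladd bilinear_radd)
  qed
  show ?thesis
    using polar[OF c, of "u c" "v c"] polar[OF c', of "u c'" "v c'"] diag[OF u] diag[OF v] diag[OF w]
    by (simp add: wc wc')
qed

lemma hessian_in_chart:
  assumes q: "q \<in> D" and c: "c \<in> charts_at M q"
    and u: "u \<in> tangent_space M q" and v: "v \<in> tangent_space M q"
  shows "hessian M f q u v = hess_in c (coord c q) (u c) (v c)"
proof -
  define k where "k = chart_at M q"
  have k: "k \<in> charts_at M q" unfolding k_def by (rule chart_at_in)
  have ka: "k \<in> atlas M" using k by (simp add: charts_at_def)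
  have "frechet_derivative (\<lambda>y. differential M f (chart_inv k y) (tvec_of M k (chart_inv k y) (v k))) (at (coord k q))
     = frechet_derivative (\<lambda>y. diff_in k y (v k)) (at (coord k q))"
  proof (rule frechet_derivative_cong_open[OF diff_in_differentiable[OF ka] open_dom_in[OF ka]])
    fix y assume "y \<in> dom_in k"
    then obtain r where "r \<in> D" "k \<in> charts_at M r" "y = coord k r" using dom_inE ka by blast
    then show "diff_in k y (v k) = differential M f (chart_inv k y) (tvec_of M k (chart_inv k y) (v k))"
      using differential_in_chart[of r k] by (simp add: tvec_of_in_tangent_space tvec_of_apply)
  qed (rule coord_in_dom_in[OF k q])+
  moreover have "differential M f q (tvec_of M k q (christoffel M k (coord k q) (u k) (v k)))
     = diff_in k (coord k q) (christoffel M k (coord k q) (u k) (v k))"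
    using differential_in_chart[OF q k tvec_of_in_tangent_space[OF k]] by (simp add: tvec_of_apply[OF k])
  ultimately have "hessian M f q u v = hess_in k (coord k q) (u k) (v k)"
    by (simp add: hessian_def cov_deriv1_def Let_def k_def[symmetric] hess_in_def)
  then show ?thesis using hess_in_change_chart[OF q k c u v] by simp
qed

text \<open>The Hessian at neighbouring points may be computed in the chart at \<open>q\<close>, by invariance.\<close>

lemma third_deriv_in_chart:
  assumes q: "q \<in> D" and u: "u \<in> tangent_space M q"
    and v: "v \<in> tangent_space M q" and w: "w \<in> tangent_space M q" and k: "k = chart_at M q"
  shows "third_deriv M f q u v w = third_in k (coord k q) (u k) (v k) (w k)"
proof -
  have kq: "k \<in> charts_at M q" unfolding k by (rule chart_at_in)
  have ka: "k \<in> atlas M" using kq by (simp add: charts_at_def)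
  have "frechet_derivative (\<lambda>y. hessian M f (chart_inv k y) (tvec_of M k (chart_inv k y) (v k))
        (tvec_of M k (chart_inv k y) (w k))) (at (coord k q))
     = frechet_derivative (\<lambda>y. hess_in k y (v k) (w k)) (at (coord k q))"
  proof (rule frechet_derivative_cong_open[OF hess_in_differentiable[OF ka] open_dom_in[OF ka]])
    fix y assume "y \<in> dom_in k"
    then obtain r where "r \<in> D" "k \<in> charts_at M r" "y = coord k r" using dom_inE ka by blast
    then show "hess_in k y (v k) (w k) = hessian M f (chart_inv k y) (tvec_of M k (chart_inv k y) (v k))
        (tvec_of M k (chart_inv k y) (w k))"
      using hessian_in_chart[of r k] by (simp add: tvec_of_in_tangent_space tvec_of_apply)
  qed (rule coord_in_dom_in[OF kq q])+
  then show ?thesis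
    by (simp add: third_deriv_def cov_deriv2_def Let_def k[symmetric] third_in_def tvec_of_apply[OF kq]
        hessian_in_chart[OF q kq tvec_of_in_tangent_space[OF kq] w]
        hessian_in_chart[OF q kq v tvec_of_in_tangent_space[OF kq]])
qed

section \<open>Derivatives along a geodesic\<close>

text \<open>A field along \<open>\<gamma>\<close> with vanishing covariant derivative at the single time \<open>t\<close>. Every tangent vector at
  \<open>\<gamma> t\<close> extends to such a field by an affine formula in a chart, whereas a field that is parallel at all
  times is the solution of a differential equation. For the derivative at \<open>t\<close> of a tensor evaluated on the
  field, one time is enough.\<close>

definition parallel_at :: "(real \<Rightarrow> 'm) \<Rightarrow> real \<Rightarrow> (real \<Rightarrow> ('m, 'e) tvec) \<Rightarrow> bool" where
  "parallel_at \<gamma> t W \<longleftrightarrow> (\<forall>\<^sub>F s in nhds t. W s \<in> tangent_space M (\<gamma> s)) \<and>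
     (let c = chart_at M (\<gamma> t) in ((\<lambda>s. W s c) has_vector_derivative
        - christoffel M c (coord c (\<gamma> t)) (velocity M \<gamma> t c) (W t c)) (at t))"

lemma parallel_at_velocity:
  assumes "geodesic_on M UNIV \<gamma>"
  shows "parallel_at \<gamma> t (velocity M \<gamma>)"
  unfolding parallel_at_def Let_def
  using velocity_in_tangent_space[OF assms] geodesic_velocity(2)[OF assms chart_at_in] by simp

lemma parallel_at_extension:
  assumes \<gamma>: "geodesic_on M UNIV \<gamma>" and w: "w \<in> tangent_space M (\<gamma> t)"
  obtains W where "parallel_at \<gamma> t W" "W t = w"
proof -
  define c where "c = chart_at M (\<gamma> t)"
  have c: "c \<in> charts_at M (\<gamma> t)" unfolding c_def by (rule chart_at_in)
  define d where "d = - christoffel M c (coord c (\<gamma> t)) (velocity M \<gamma> t c) (w c)"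
  define W where "W s = tvec_of M c (\<gamma> s) (w c + (s - t) *\<^sub>R d)" for s
  have Wt: "W t = w" unfolding W_def using tvec_of_coords[OF c w] by simp
  have "\<forall>\<^sub>F s in nhds t. W s \<in> tangent_space M (\<gamma> s)"
    using geodesic_eventually_chart[OF \<gamma> c] unfolding W_def
    by eventually_elim (rule tvec_of_in_tangent_space)
  moreover have "((\<lambda>s. W s c) has_vector_derivative d) (at t)"
  proof -
    have "((\<lambda>s. w c + (s - t) *\<^sub>R d) has_vector_derivative d) (at t)"
      by (auto intro!: derivative_eq_intros)
    moreover have "\<forall>\<^sub>F s in nhds t. w c + (s - t) *\<^sub>R d = W s c"
      using geodesic_eventually_chart[OF \<gamma> c] unfolding W_def
      by eventually_elim (simp add: tvec_of_apply)
    ultimately show ?thesis by (rule has_vector_derivative_cong_nhds)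
  qed
  ultimately have "parallel_at \<gamma> t W"
    unfolding parallel_at_def Let_def c_def[symmetric] Wt d_def by blast
  then show thesis using Wt that by blast
qed

lemma function_along_geodesic:
  assumes \<gamma>: "geodesic_on M UNIV \<gamma>" and D: "\<gamma> t \<in> D"
  shows "((\<lambda>s. f (\<gamma> s)) has_real_derivative differential M f (\<gamma> t) (velocity M \<gamma> t)) (at t)"
proof -
  define c where "c = chart_at M (\<gamma> t)"
  have c: "c \<in> charts_at M (\<gamma> t)" unfolding c_def by (rule chart_at_in)
  have ca: "c \<in> atlas M" using c by (simp add: charts_at_def)
  have "((\<lambda>r. (f \<circ> chart_inv c) (coord c (\<gamma> r))) has_vector_derivative
     diff_in c (coord c (\<gamma> t)) (velocity M \<gamma> t c)) (at t)"
    unfolding diff_in_def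
    by (rule has_vector_derivative_along_curve[OF geodesic_velocity(1)[OF \<gamma> c]])
       (rule smooth_on_differentiable[OF f_chart_smooth[OF ca] coord_in_dom_in[OF c D]])
  moreover have "\<forall>\<^sub>F r in nhds t. (f \<circ> chart_inv c) (coord c (\<gamma> r)) = f (\<gamma> r)"
    using geodesic_eventually_chart[OF \<gamma> c] by eventually_elim simp
  ultimately show ?thesis
    unfolding has_real_derivative_iff_has_vector_derivative[symmetric]
      differential_in_chart[OF D c velocity_in_tangent_space[OF \<gamma>]]
    by (rule has_real_derivative_cong_nhds)
qed

lemma differential_along_geodesic:
  assumes \<gamma>: "geodesic_on M UNIV \<gamma>" and D: "\<gamma> t \<in> D" and W: "parallel_at \<gamma> t W"
  shows "((\<lambda>s. differential M f (\<gamma> s) (W s)) has_real_derivative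
     hessian M f (\<gamma> t) (velocity M \<gamma> t) (W t)) (at t)"
proof -
  define c where "c = chart_at M (\<gamma> t)"
  have c: "c \<in> charts_at M (\<gamma> t)" unfolding c_def by (rule chart_at_in)
  have ca: "c \<in> atlas M" using c by (simp add: charts_at_def)
  have WT: "\<forall>\<^sub>F s in nhds t. W s \<in> tangent_space M (\<gamma> s)"
    and Wd: "((\<lambda>s. W s c) has_vector_derivative
        - christoffel M c (coord c (\<gamma> t)) (velocity M \<gamma> t c) (W t c)) (at t)"
    using W unfolding parallel_at_def Let_def c_def[symmetric] by auto
  have Wt: "W t \<in> tangent_space M (\<gamma> t)" using WT by (rule eventually_nhds_x_imp_x)
  have "((\<lambda>s. diff_in c (coord c (\<gamma> s)) (W s c)) has_real_derivative
     hess_in c (coord c (\<gamma> t)) (velocity M \<gamma> t c) (W t c)) (at t)"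
    by (rule diff_in_along_curve[OF ca coord_in_dom_in[OF c D] geodesic_velocity(1)[OF \<gamma> c] Wd])
  moreover have "\<forall>\<^sub>F s in nhds t. diff_in c (coord c (\<gamma> s)) (W s c) = differential M f (\<gamma> s) (W s)"
    using geodesic_eventually_chart[OF \<gamma> c] geodesic_eventually_in[OF \<gamma> open_D D] WT
    by eventually_elim (rule differential_in_chart[symmetric])
  ultimately show ?thesis
    unfolding hessian_in_chart[OF D c velocity_in_tangent_space[OF \<gamma>] Wt]
    by (rule has_real_derivative_cong_nhds)
qed

lemma hessian_along_geodesic:
  assumes \<gamma>: "geodesic_on M UNIV \<gamma>" and D: "\<gamma> t \<in> D"
    and V: "parallel_at \<gamma> t V" and W: "parallel_at \<gamma> t W"
  shows "((\<lambda>s. hessian M f (\<gamma> s) (V s) (W s)) has_real_derivative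
     third_deriv M f (\<gamma> t) (velocity M \<gamma> t) (V t) (W t)) (at t)"
proof -
  define c where "c = chart_at M (\<gamma> t)"
  have c: "c \<in> charts_at M (\<gamma> t)" unfolding c_def by (rule chart_at_in)
  have ca: "c \<in> atlas M" using c by (simp add: charts_at_def)
  have WT: "\<forall>\<^sub>F s in nhds t. W s \<in> tangent_space M (\<gamma> s)"
    and Wd: "((\<lambda>s. W s c) has_vector_derivative
        - christoffel M c (coord c (\<gamma> t)) (velocity M \<gamma> t c) (W t c)) (at t)"
    using W unfolding parallel_at_def Let_def c_def[symmetric] by auto
  have VT: "\<forall>\<^sub>F s in nhds t. V s \<in> tangent_space M (\<gamma> s)"
    and Vd: "((\<lambda>s. V s c) has_vector_derivative
        - christoffel M c (coord c (\<gamma> t)) (velocity M \<gamma> t c) (V t c)) (at t)"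
    using V unfolding parallel_at_def Let_def c_def[symmetric] by auto
  have Vt: "V t \<in> tangent_space M (\<gamma> t)" using VT by (rule eventually_nhds_x_imp_x)
  have Wt: "W t \<in> tangent_space M (\<gamma> t)" using WT by (rule eventually_nhds_x_imp_x)
  have "((\<lambda>s. hess_in c (coord c (\<gamma> s)) (V s c) (W s c)) has_real_derivative
     third_in c (coord c (\<gamma> t)) (velocity M \<gamma> t c) (V t c) (W t c)) (at t)"
    by (rule hess_in_along_curve[OF ca coord_in_dom_in[OF c D] geodesic_velocity(1)[OF \<gamma> c] Vd Wd])
  moreover have "\<forall>\<^sub>F s in nhds t. hess_in c (coord c (\<gamma> s)) (V s c) (W s c) = hessian M f (\<gamma> s) (V s) (W s)"
    using geodesic_eventually_chart[OF \<gamma> c] geodesic_eventually_in[OF \<gamma> open_D D] VT WT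
    by eventually_elim (rule hessian_in_chart[symmetric])
  ultimately show ?thesis
    unfolding third_deriv_in_chart[OF D velocity_in_tangent_space[OF \<gamma>] Vt Wt c_def]
    by (rule has_real_derivative_cong_nhds)
qed

end

section \<open>Self-concordant functions\<close>

locale self_concordant_mfd = smooth_function_mfd M D f
  for M :: "('m::{t2_space, second_countable_topology}, 'e::euclidean_space) riemannian"
    and D :: "'m set" and f :: "'m \<Rightarrow> real" +
  fixes \<alpha> :: real
  assumes \<alpha>: "\<alpha> > 0"
    and third_bound: "\<And>q u v w. q \<in> D \<Longrightarrow> u \<in> tangent_space M q \<Longrightarrow> v \<in> tangent_space M q \<Longrightarrow>
      w \<in> tangent_space M q \<Longrightarrow> \<bar>third_deriv M f q u v w\<bar> \<le> 2 / sqrt \<alpha> *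
          sqrt (hessian M f q u u) * sqrt (hessian M f q v v) * sqrt (hessian M f q w w)"
    and closed_epigraph: "closed {(q, t). q \<in> D \<and> f q \<le> t}"
    and hessian_pos: "\<And>q u. q \<in> D \<Longrightarrow> u \<in> tangent_space M q \<Longrightarrow> u \<noteq> (\<lambda>_. 0) \<Longrightarrow>
      0 < hessian M f q u u"
begin

lemma tvec_of_nonzero: "c \<in> charts_at M q \<Longrightarrow> a \<noteq> 0 \<Longrightarrow> tvec_of M c q a \<noteq> (\<lambda>_. 0)"
  using tvec_of_apply by metis

lemma hess_in_pos:
  assumes q: "q \<in> D" and c: "c \<in> charts_at M q" and a: "a \<noteq> 0"
  shows "0 < hess_in c (coord c q) a a"
  using hessian_pos[OF q tvec_of_in_tangent_space[OF c] tvec_of_nonzero[OF c a]]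
  by (simp add: hessian_in_chart[OF q c] tvec_of_in_tangent_space[OF c] tvec_of_apply[OF c])

lemma hessian_zero:
  assumes q: "q \<in> D" and "(\<lambda>_. 0) \<in> tangent_space M q"
  shows "hessian M f q (\<lambda>_. 0) (\<lambda>_. 0) = 0"
proof -
  have c: "chart_at M q \<in> atlas M" using chart_at_in[of q] by (simp add: charts_at_def)
  show ?thesis
    using hessian_in_chart[OF q chart_at_in assms(2,2)]
      bilinear_lzero[OF hess_in_bilinear[OF c coord_in_dom_in[OF chart_at_in q]]] by simp
qed

lemma hessian_nonneg: "q \<in> D \<Longrightarrow> u \<in> tangent_space M q \<Longrightarrow> 0 \<le> hessian M f q u u"
  using hessian_zero hessian_pos by (cases "u = (\<lambda>_. 0)") (auto simp: less_imp_le)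

section \<open>The Newton step and the Newton decrement\<close>

text \<open>Completing the square: with \<open>n\<close> a solution of \<open>H(n, \<cdot>) = -df\<close>, the quadratic model at \<open>u\<close> exceeds its
  value at \<open>n\<close> by \<open>H(u - n, u - n) / 2\<close>.\<close>

lemma newton_step_equation:
  assumes q: "q \<in> D"
  shows "newton_step M f q \<in> tangent_space M q"
    and "w \<in> tangent_space M q \<Longrightarrow> hessian M f q (newton_step M f q) w = - differential M f q w"
proof -
  define c where "c = chart_at M q"
  have c: "c \<in> charts_at M q" unfolding c_def by (rule chart_at_in)
  have ca: "c \<in> atlas M" using c by (simp add: charts_at_def)
  define x where "x = coord c q"
  have x: "x \<in> dom_in c" unfolding x_def by (rule coord_in_dom_in[OF c q])
  define g where "g = hess_in c x"
  have g: "bilinear g" unfolding g_def by (rule hess_in_bilinear[OF ca x])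
  have sym: "g a b = g b a" for a b unfolding g_def by (rule hess_in_commute[OF ca x])
  have pos: "0 < g a a" if "a \<noteq> 0" for a unfolding g_def x_def by (rule hess_in_pos[OF q c that])
  have "linear (\<lambda>b. - diff_in c x b)" using diff_in_linear[OF ca x] by (rule linear_compose_neg)
  then obtain z where z: "\<And>b. g z b = - diff_in c x b"
    using positive_definite_solvable[OF g pos] by blast
  define n where "n = tvec_of M c q z"
  have n: "n \<in> tangent_space M q" "n c = z"
    unfolding n_def by (rule tvec_of_in_tangent_space[OF c], rule tvec_of_apply[OF c])
  define Q where "Q u = f q + differential M f q u + hessian M f q u u / 2" for u
  have Q: "Q u = Q n + g (u c - z) (u c - z) / 2" if u: "u \<in> tangent_space M q" for u
  proof -
    have d: "diff_in c x b = - g z b" for b using z[of b] by simp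
    show ?thesis unfolding Q_def
      by (simp add: differential_in_chart[OF q c] hessian_in_chart[OF q c] u n x_def[symmetric]
          g_def[symmetric] d bilinear_lsub[OF g] bilinear_rsub[OF g] sym[of "u c" z] field_simps)
  qed
  have "newton_step M f q = n"
    unfolding newton_step_def Q_def[symmetric]
  proof (rule the_equality)
    show "is_arg_min Q (\<lambda>u. u \<in> tangent_space M q) n"
      unfolding is_arg_min_def
    proof (intro conjI n notI)
      assume "\<exists>u. u \<in> tangent_space M q \<and> Q u < Q n"
      then obtain u where u: "u \<in> tangent_space M q" "Q u < Q n" by blast
      then have "g (u c - z) (u c - z) < 0" using Q[of u] by simp
      then show False using pos[of "u c - z"] bilinear_lzero[OF g] by (cases "u c - z = 0") auto
    qed
  next
    fix u assume "is_arg_min Q (\<lambda>u. u \<in> tangent_space M q) u"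
    then have u: "u \<in> tangent_space M q" "\<not> Q n < Q u" using n unfolding is_arg_min_def by auto
    then have "\<not> 0 < g (u c - z) (u c - z)" using Q[of u] by simp
    then have "u c = z" using pos[of "u c - z"] by auto
    then show "u = n" unfolding n_def using tvec_of_coords[OF c u(1)] by simp
  qed
  moreover have "hessian M f q n w = - differential M f q w" if "w \<in> tangent_space M q" for w
    by (simp add: differential_in_chart[OF q c that] hessian_in_chart[OF q c n(1) that] n(2) x_def[symmetric]
          g_def[symmetric] z)
  ultimately show "newton_step M f q \<in> tangent_space M q"
    "w \<in> tangent_space M q \<Longrightarrow> hessian M f q (newton_step M f q) w = - differential M f q w"
    using n by auto
qed

lemma nonzero_tangent_vector: "tangent_space M q - {\<lambda>_. 0} \<noteq> {}"
proof -
  obtain b :: 'e where "b \<in> Basis" using nonempty_Basis by blast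
  then have "b \<noteq> 0" by (rule nonzero_Basis)
  then show ?thesis
    using tvec_of_nonzero[OF chart_at_in, of b q] tvec_of_in_tangent_space[OF chart_at_in, of q b] by blast
qed

text \<open>By the Newton equation and Cauchy-Schwarz, the quotients in the supremum are at most
  \<open>\<surd>(H(n, n) / \<alpha>)\<close>, so the supremum is an upper bound of them, and the quotient at a nonzero Newton
  step \<open>n\<close> has exactly this value.\<close>

lemma newton_decrement_bounds:
  assumes q: "q \<in> D"
  shows "0 \<le> newton_decrement M f \<alpha> q"
    and "hessian M f q (newton_step M f q) (newton_step M f q) \<le> \<alpha> * (newton_decrement M f \<alpha> q)\<^sup>2"
proof -
  define n where "n = newton_step M f q"
  note n = newton_step_equation[OF q, folded n_def]
  define r where "r u = \<bar>differential M f q u\<bar> / sqrt (\<alpha> * hessian M f q u u)" for u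
  have CS: "\<bar>hessian M f q n u\<bar> \<le> sqrt (hessian M f q n n) * sqrt (hessian M f q u u)"
    if u: "u \<in> tangent_space M q" for u
  proof -
    define c where "c = chart_at M q"
    have c: "c \<in> charts_at M q" unfolding c_def by (rule chart_at_in)
    have ca: "c \<in> atlas M" using c by (simp add: charts_at_def)
    have x: "coord c q \<in> dom_in c" by (rule coord_in_dom_in[OF c q])
    show ?thesis
      unfolding hessian_in_chart[OF q c n(1) u] hessian_in_chart[OF q c n(1) n(1)] hessian_in_chart[OF q c u u]
      by (rule bilinear_Cauchy_Schwarz[OF hess_in_bilinear[OF ca x] hess_in_commute[OF ca x] hess_in_pos[OF q c]])
  qed
  have "r u \<le> sqrt (hessian M f q n n) / sqrt \<alpha>" if u: "u \<in> tangent_space M q - {\<lambda>_. 0}" for u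
  proof -
    have H: "0 < sqrt (hessian M f q u u)" using hessian_pos[OF q] u by simp
    have "\<bar>differential M f q u\<bar> \<le> sqrt (hessian M f q n n) * sqrt (hessian M f q u u)"
      using CS[of u] n(2)[of u] u by simp
    then show ?thesis using H \<alpha> by (simp add: r_def real_sqrt_mult field_simps)
  qed
  then have bdd: "bdd_above (r ` (tangent_space M q - {\<lambda>_. 0}))" by (rule bdd_aboveI2)
  have lam: "newton_decrement M f \<alpha> q = (SUP u\<in>tangent_space M q - {\<lambda>_. 0}. r u)"
    unfolding newton_decrement_def r_def ..
  have upper: "r u \<le> newton_decrement M f \<alpha> q" if "u \<in> tangent_space M q - {\<lambda>_. 0}" for u
    unfolding lam by (rule cSUP_upper[OF that bdd])
  obtain u where u: "u \<in> tangent_space M q - {\<lambda>_. 0}" using nonzero_tangent_vector by blast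
  have "0 \<le> r u" using u hessian_nonneg[OF q, of u] \<alpha> by (simp add: r_def)
  then show nonneg: "0 \<le> newton_decrement M f \<alpha> q" using upper[OF u] by simp
  have "hessian M f q n n \<le> \<alpha> * (newton_decrement M f \<alpha> q)\<^sup>2"
  proof (cases "n = (\<lambda>_. 0)")
    case True
    then show ?thesis using hessian_zero[OF q] n(1) \<alpha> by simp
  next
    case False
    then have H: "0 < hessian M f q n n" using hessian_pos[OF q n(1)] by simp
    have "\<bar>differential M f q n\<bar> = hessian M f q n n" using n(2)[OF n(1)] H by simp
    then have "r n = sqrt (hessian M f q n n) / sqrt \<alpha>"
      using H \<alpha> by (simp add: r_def real_sqrt_mult real_div_sqrt field_simps)
    then have "sqrt (hessian M f q n n) / sqrt \<alpha> \<le> newton_decrement M f \<alpha> q"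
      using upper[of n] n(1) False by simp
    then have "sqrt (hessian M f q n n) \<le> sqrt \<alpha> * newton_decrement M f \<alpha> q"
      using \<alpha> by (simp add: field_simps)
    then have "(sqrt (hessian M f q n n))\<^sup>2 \<le> (sqrt \<alpha> * newton_decrement M f \<alpha> q)\<^sup>2"
      using H by (intro power_mono) auto
    then show ?thesis using H \<alpha> by (simp add: power_mult_distrib)
  qed
  then show "hessian M f q (newton_step M f q) (newton_step M f q) \<le> \<alpha> * (newton_decrement M f \<alpha> q)\<^sup>2"
    unfolding n_def .
qed

section \<open>The geodesic of the Newton step stays in the domain\<close>

text \<open>The barrier \<open>B = \<alpha> (\<delta> / (1 - t \<mu>))\<^sup>2\<close> has derivative \<open>2 \<mu> \<alpha> \<delta>\<^sup>2 / (1 - t \<mu>)\<^sup>3\<close>, while by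
  self-concordance the derivative of \<open>H(v, v)\<close> is at most \<open>2 \<delta> \<alpha> \<delta>\<^sup>2 / (1 - t \<mu>)\<^sup>3\<close> where \<open>H(v, v) \<le> B\<close>. The
  gap \<open>\<delta> < \<mu>\<close> makes the comparison strict. Comparing the squared norm \<open>H(v, v)\<close> itself, and not
  \<open>1 / \<surd>H(v, v)\<close>, includes the case of a vanishing Newton step.\<close>

lemma geodesic_stays_in_domain:
  assumes \<gamma>: "geodesic_on M UNIV \<gamma>" and D0: "\<gamma> 0 \<in> D"
    and \<delta>: "0 < \<delta>" "\<delta> < \<mu>" "\<mu> < 1"
    and h0: "hessian M f (\<gamma> 0) (velocity M \<gamma> 0) (velocity M \<gamma> 0) < \<alpha> * \<delta>\<^sup>2"
    and t: "0 \<le> t" "t \<le> 1"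
  shows "\<gamma> t \<in> D \<and> hessian M f (\<gamma> t) (velocity M \<gamma> t) (velocity M \<gamma> t) < \<alpha> * (\<delta> / (1 - t * \<mu>))\<^sup>2"
proof -
  define H where "H s = hessian M f (\<gamma> s) (velocity M \<gamma> s) (velocity M \<gamma> s)" for s
  define B where "B s = \<alpha> * (\<delta> / (1 - s * \<mu>))\<^sup>2" for s
  have den: "1 - s * \<mu> > 0" if "s \<le> 1" for s
  proof -
    have "s * \<mu> \<le> 1 * \<mu>" using that \<delta> by (intro mult_right_mono) auto
    then show ?thesis using \<delta> by linarith
  qed
  have dH: "(H has_real_derivative third_deriv M f (\<gamma> s) (velocity M \<gamma> s) (velocity M \<gamma> s) (velocity M \<gamma> s)) (at s)"
    if "\<gamma> s \<in> D" for s
    unfolding H_def by (rule hessian_along_geodesic[OF \<gamma> that parallel_at_velocity[OF \<gamma>] parallel_at_velocity[OF \<gamma>]])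
  have dB: "(B has_real_derivative 2 * \<alpha> * \<delta>\<^sup>2 * \<mu> / (1 - s * \<mu>) ^ 3) (at s)" if "s \<le> 1" for s
  proof -
    have "((\<lambda>s. \<delta> / (1 - s * \<mu>)) has_real_derivative \<delta> * \<mu> / (1 - s * \<mu>)\<^sup>2) (at s)"
      using den[OF that] by (auto intro!: derivative_eq_intros simp: power2_eq_square)
    from DERIV_cmult[OF DERIV_power[OF this, of 2], of \<alpha>]
    show ?thesis unfolding B_def by (simp add: power2_eq_square power3_eq_cube mult_ac)
  qed
  have B1: "B s \<le> B 1" if "0 \<le> s" "s \<le> 1" for s
    unfolding B_def using that \<alpha> \<delta> den[OF that(2)]
    by (intro mult_left_mono power_mono divide_left_mono mult_pos_pos) auto
  have "\<gamma> t \<in> D \<and> H t < B t"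
  proof (rule real_interval_induct[where Q = "\<lambda>s. \<gamma> s \<in> D \<and> H s < B s", OF _ _ t])
    fix t :: real assume t: "0 \<le> t" "t < 1" and Q: "\<gamma> t \<in> D \<and> H t < B t"
    have "isCont (\<lambda>s. H s - B s) t"
      using DERIV_isCont[OF dH] DERIV_isCont[OF dB[of t]] Q t by (intro continuous_diff) auto
    then have "((\<lambda>s. H s - B s) \<longlongrightarrow> H t - B t) (nhds t)" by (rule isCont_tendsto_nhds)
    then have "\<forall>\<^sub>F s in nhds t. H s - B s < 0" using Q by (intro order_tendstoD) auto
    with geodesic_eventually_in[OF \<gamma> open_D, of t] Q
    have "\<forall>\<^sub>F s in nhds t. \<gamma> s \<in> D \<and> H s < B s" by (auto elim: eventually_elim2)
    then show "\<forall>\<^sub>F s in at_right t. \<gamma> s \<in> D \<and> H s < B s"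
      by (rule filter_leD[OF at_within_le_nhds])
  next
    fix t :: real assume t: "0 \<le> t" "t \<le> 1" and Q: "\<And>s. 0 \<le> s \<Longrightarrow> s < t \<Longrightarrow> \<gamma> s \<in> D \<and> H s < B s"
    show "\<gamma> t \<in> D \<and> H t < B t"
    proof (cases "t = 0")
      case True
      then show ?thesis using D0 h0 by (simp add: H_def B_def)
    next
      case False
      then have t0: "0 < t" using t by simp
      define \<phi>' where "\<phi>' s = differential M f (\<gamma> s) (velocity M \<gamma> s)" for s
      \<comment> \<open>A bound for \<open>f\<close> along \<open>\<gamma>\<close> before time \<open>t\<close>, from Taylor's formula with second derivative at most \<open>B 1\<close>. It
        puts the points \<open>(\<gamma> s, C)\<close> in the closed epigraph, which then contains their limit \<open>(\<gamma> t, C)\<close>.\<close>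
      define C where "C = f (\<gamma> 0) + \<bar>\<phi>' 0\<bar> + B 1"
      have Bn: "0 \<le> B 1" unfolding B_def using \<alpha> by simp
      have bound: "f (\<gamma> s) \<le> C" if s: "0 \<le> s" "s < t" for s
      proof -
        have d\<phi>: "((\<lambda>s. f (\<gamma> s)) has_real_derivative \<phi>' r) (at r)" if "0 \<le> r" "r \<le> s" for r
          unfolding \<phi>'_def using function_along_geodesic[OF \<gamma>] Q[of r] that s by simp
        have d\<phi>': "(\<phi>' has_real_derivative H r) (at r)" if "0 \<le> r" "r \<le> s" for r
          unfolding \<phi>'_def H_def
          using differential_along_geodesic[OF \<gamma> _ parallel_at_velocity[OF \<gamma>], of r] Q[of r] that s by simp
        have one: "\<phi>' r - B 1 * r \<le> \<phi>' 0 - B 1 * 0" if r: "0 \<le> r" "r \<le> s" for r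
        proof (rule DERIV_nonpos_imp_nonincreasing[OF r(1)])
          fix y assume y: "0 \<le> y" "y \<le> r"
          have "((\<lambda>y. \<phi>' y - B 1 * y) has_real_derivative H y - B 1) (at y)"
            using d\<phi>'[of y] y r by (auto intro!: derivative_eq_intros)
          moreover have "H y \<le> B 1" using Q[of y] B1[of y] y r s t by force
          ultimately show "\<exists>d. ((\<lambda>y. \<phi>' y - B 1 * y) has_real_derivative d) (at y) \<and> d \<le> 0"
            by (intro exI[of _ "H y - B 1"]) auto
        qed
        have "f (\<gamma> s) - \<phi>' 0 * s - B 1 * s\<^sup>2 / 2 \<le> f (\<gamma> 0) - \<phi>' 0 * 0 - B 1 * 0\<^sup>2 / 2"
        proof (rule DERIV_nonpos_imp_nonincreasing[OF s(1)])
          fix y assume y: "0 \<le> y" "y \<le> s"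
          have "((\<lambda>s. f (\<gamma> s) - \<phi>' 0 * s - B 1 * s\<^sup>2 / 2) has_real_derivative \<phi>' y - \<phi>' 0 - B 1 * y) (at y)"
            using d\<phi>[of y] y by (auto intro!: derivative_eq_intros)
          then show "\<exists>d. ((\<lambda>s. f (\<gamma> s) - \<phi>' 0 * s - B 1 * s\<^sup>2 / 2) has_real_derivative d) (at y) \<and> d \<le> 0"
            using one[OF y] by (intro exI[of _ "\<phi>' y - \<phi>' 0 - B 1 * y"]) auto
        qed
        moreover have "\<phi>' 0 * s \<le> \<bar>\<phi>' 0\<bar>"
        proof -
          have "\<phi>' 0 * s \<le> \<bar>\<phi>' 0\<bar> * s" using s by (intro mult_right_mono) auto
          also have "\<dots> \<le> \<bar>\<phi>' 0\<bar> * 1" using s t by (intro mult_left_mono) auto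
          finally show ?thesis by simp
        qed
        moreover have "B 1 * s\<^sup>2 / 2 \<le> B 1"
        proof -
          have "s\<^sup>2 \<le> 1" using s t by (simp add: power_le_one)
          then have "B 1 * s\<^sup>2 \<le> B 1 * 1" using Bn by (intro mult_left_mono) auto
          then show ?thesis using Bn by simp
        qed
        ultimately show ?thesis unfolding C_def by simp
      qed
      have ev: "\<forall>\<^sub>F s in at_left t. 0 \<le> s \<and> s < t"
        unfolding eventually_at_left_field using t0 by (intro exI[of _ 0]) auto
      have "(\<gamma> \<longlongrightarrow> \<gamma> t) (at_left t)"
        using geodesic_isCont[OF \<gamma>, of t] unfolding isCont_def
        by (rule tendsto_within_subset) simp
      then have lim: "((\<lambda>s. (\<gamma> s, C)) \<longlongrightarrow> (\<gamma> t, C)) (at_left t)" by (intro tendsto_Pair tendsto_const)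
      have "\<forall>\<^sub>F s in at_left t. (\<gamma> s, C) \<in> {(q, t). q \<in> D \<and> f q \<le> t}"
        using ev by eventually_elim (use Q bound in auto)
      then have "(\<gamma> t, C) \<in> {(q, t). q \<in> D \<and> f q \<le> t}"
        by (rule Lim_in_closed_set[OF closed_epigraph _ _ lim]) simp
      then have Dt: "\<gamma> t \<in> D" by simp
      have evH: "\<forall>\<^sub>F s in at_left t. H s - B s < 0"
        using ev by eventually_elim (use Q in auto)
      have "isCont (\<lambda>s. H s - B s) t"
        using DERIV_isCont[OF dH] DERIV_isCont[OF dB[of t]] Dt t by (intro continuous_diff) auto
      then have "((\<lambda>s. H s - B s) \<longlongrightarrow> H t - B t) (at_left t)"
        unfolding isCont_def by (rule tendsto_within_subset) simp
      then have "H t - B t \<le> 0"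
        by (rule tendsto_upperbound) (use evH in \<open>auto elim: eventually_mono\<close>)
      then have "sqrt (H t) \<le> sqrt (B t)" by simp
      also have "sqrt (B t) = sqrt \<alpha> * (\<delta> / (1 - t * \<mu>))"
        unfolding B_def using \<delta> den[OF t(2)] by (simp add: real_sqrt_mult)
      finally have sq: "sqrt (H t) \<le> sqrt \<alpha> * (\<delta> / (1 - t * \<mu>))" .
      have "third_deriv M f (\<gamma> t) (velocity M \<gamma> t) (velocity M \<gamma> t) (velocity M \<gamma> t)
         \<le> 2 / sqrt \<alpha> * sqrt (H t) ^ 3"
        using third_bound[OF Dt, of "velocity M \<gamma> t" "velocity M \<gamma> t" "velocity M \<gamma> t"]
          velocity_in_tangent_space[OF \<gamma>, of t]
        by (simp add: H_def power3_eq_cube mult.assoc)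
      also have "\<dots> \<le> 2 / sqrt \<alpha> * (sqrt \<alpha> * (\<delta> / (1 - t * \<mu>))) ^ 3"
        using sq \<alpha> hessian_nonneg[OF Dt velocity_in_tangent_space[OF \<gamma>]]
        by (intro mult_left_mono power_mono) (auto simp: H_def)
      also have "\<dots> = 2 * \<alpha> * \<delta> ^ 3 / (1 - t * \<mu>) ^ 3"
        using \<alpha> by (simp add: power3_eq_cube)
      also have "\<dots> < 2 * \<alpha> * \<delta>\<^sup>2 * \<mu> / (1 - t * \<mu>) ^ 3"
        using \<alpha> \<delta> den[OF t(2)] by (intro divide_strict_right_mono) (auto simp: power3_eq_cube power2_eq_square)
      finally have neg: "third_deriv M f (\<gamma> t) (velocity M \<gamma> t) (velocity M \<gamma> t) (velocity M \<gamma> t)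
         - 2 * \<alpha> * \<delta>\<^sup>2 * \<mu> / (1 - t * \<mu>) ^ 3 < 0" by simp
      have "H t - B t < 0"
        by (rule negative_derivative_imp_negative[OF DERIV_diff[OF dH[OF Dt] dB[OF t(2)]] neg t0 evH])
      then show ?thesis using Dt by simp
    qed
  qed
  then show ?thesis unfolding H_def B_def .
qed

section \<open>The differential along the Newton geodesic\<close>

text \<open>With \<open>m = \<mu> / (1 - t \<mu>)\<close>, the bound \<open>b\<close> on the dual norm of \<open>df + (1 - t) H(v, \<cdot>)\<close> has to satisfy
  \<open>b' > 2 \<surd>\<alpha> (1 - t) m\<^sup>2 + m b\<close>: the first term bounds the covariant derivative of the covector, the second
  the change of the norm. The substitution \<open>b = \<surd>\<alpha> y / (1 - t \<mu>)\<close> removes the second term and leaves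
  \<open>y' > 2 (1 - t) \<mu>\<^sup>2 / (1 - t \<mu>)\<close>. Because \<open>1 - t \<mu> \<ge> 1 - \<mu>\<close>, integrating \<open>2 (1 - t) \<mu>\<^sup>2 / (1 - \<mu>)\<close> gives
  a solution; the terms with \<open>\<eta>\<close> make \<open>y\<close> positive at time 0 and the inequality strict.\<close>

lemma differential_barrier:
  assumes \<gamma>: "geodesic_on M UNIV \<gamma>" and \<mu>: "0 < \<mu>" "\<mu> < 1" and \<eta>: "0 < \<eta>"
    and D: "\<And>t. 0 \<le> t \<Longrightarrow> t \<le> 1 \<Longrightarrow> \<gamma> t \<in> D"
    and h: "\<And>t. 0 \<le> t \<Longrightarrow> t \<le> 1 \<Longrightarrow>
      hessian M f (\<gamma> t) (velocity M \<gamma> t) (velocity M \<gamma> t) \<le> \<alpha> * (\<mu> / (1 - t * \<mu>))\<^sup>2"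
    and newton: "\<And>w. w \<in> tangent_space M (\<gamma> 0) \<Longrightarrow>
      hessian M f (\<gamma> 0) (velocity M \<gamma> 0) w = - differential M f (\<gamma> 0) w"
    and w: "w \<in> tangent_space M (\<gamma> 1)" "w \<noteq> (\<lambda>_. 0)"
  shows "differential M f (\<gamma> 1) w
    < sqrt \<alpha> * ((2 * \<eta> + \<mu>\<^sup>2 / (1 - \<mu>)) / (1 - \<mu>)) * sqrt (hessian M f (\<gamma> 1) w w)"
proof -
  define y where "y t = \<eta> + \<eta> * t + (2 * t - t\<^sup>2) * (\<mu>\<^sup>2 / (1 - \<mu>))" for t
  define b where "b t = sqrt \<alpha> * (y t / (1 - t * \<mu>))" for t
  define b' where "b' t = sqrt \<alpha> * ((\<eta> + (2 - 2 * t) * (\<mu>\<^sup>2 / (1 - \<mu>))) / (1 - t * \<mu>)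
      + y t * \<mu> / (1 - t * \<mu>)\<^sup>2)" for t
  define V where "V t w = differential M f (\<gamma> t) w + (1 - t) * hessian M f (\<gamma> t) (velocity M \<gamma> t) w
      - b t * sqrt (hessian M f (\<gamma> t) w w)" for t w
  have den: "1 - s * \<mu> > 0" if "s \<le> 1" for s
  proof -
    have "s * \<mu> \<le> 1 * \<mu>" using that \<mu> by (intro mult_right_mono) auto
    then show ?thesis using \<mu> by linarith
  qed
  have db: "(b has_real_derivative b' t) (at t)" if "t \<le> 1" for t
  proof -
    have y: "(y has_real_derivative \<eta> + (2 - 2 * t) * (\<mu>\<^sup>2 / (1 - \<mu>))) (at t)"
      unfolding y_def by (rule derivative_eq_intros refl | simp)+
    have "((\<lambda>t. y t / (1 - t * \<mu>)) has_real_derivative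
        ((\<eta> + (2 - 2 * t) * (\<mu>\<^sup>2 / (1 - \<mu>))) * (1 - t * \<mu>) - y t * (- \<mu>)) / ((1 - t * \<mu>) * (1 - t * \<mu>))) (at t)"
      using den[OF that] by (intro DERIV_divide y) (auto intro!: derivative_eq_intros)
    moreover have "((\<eta> + (2 - 2 * t) * (\<mu>\<^sup>2 / (1 - \<mu>))) * (1 - t * \<mu>) - y t * (- \<mu>)) / ((1 - t * \<mu>) * (1 - t * \<mu>))
       = (\<eta> + (2 - 2 * t) * (\<mu>\<^sup>2 / (1 - \<mu>))) / (1 - t * \<mu>) + y t * \<mu> / (1 - t * \<mu>)\<^sup>2"
      using den[OF that] by (simp add: power2_eq_square add_divide_distrib)
    ultimately have "((\<lambda>t. y t / (1 - t * \<mu>)) has_real_derivative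
        (\<eta> + (2 - 2 * t) * (\<mu>\<^sup>2 / (1 - \<mu>))) / (1 - t * \<mu>) + y t * \<mu> / (1 - t * \<mu>)\<^sup>2) (at t)"
      by (simp only:)
    then show ?thesis unfolding b_def b'_def by (rule DERIV_cmult)
  qed
  have ypos: "0 < y t" if "0 \<le> t" "t \<le> 1" for t
  proof -
    have "0 \<le> 2 * t - t\<^sup>2" using that by (simp add: power2_eq_square) (smt (verit) mult_left_le)
    then show ?thesis unfolding y_def using \<eta> \<mu> that by (intro add_pos_nonneg mult_nonneg_nonneg) auto
  qed
  have vT: "velocity M \<gamma> t \<in> tangent_space M (\<gamma> t)" for t by (rule velocity_in_tangent_space[OF \<gamma>])
  have "\<forall>w\<in>tangent_space M (\<gamma> 1) - {\<lambda>_. 0}. V 1 w < 0"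
  proof (rule real_interval_induct[where Q = "\<lambda>t. \<forall>w\<in>tangent_space M (\<gamma> t) - {\<lambda>_. 0}. V t w < 0"])
    \<comment> \<open>Openness: \<open>V\<close> is positively homogeneous in \<open>w\<close>, so it suffices to treat the compact unit sphere of a chart.\<close>
    fix t :: real assume t: "0 \<le> t" "t < 1" and Q: "\<forall>w\<in>tangent_space M (\<gamma> t) - {\<lambda>_. 0}. V t w < 0"
    have Dt: "\<gamma> t \<in> D" using D t by simp
    define c where "c = chart_at M (\<gamma> t)"
    have c: "c \<in> charts_at M (\<gamma> t)" unfolding c_def by (rule chart_at_in)
    have ca: "c \<in> atlas M" using c by (simp add: charts_at_def)
    have x: "coord c (\<gamma> t) \<in> dom_in c" by (rule coord_in_dom_in[OF c Dt])
    define N where "N r = diff_in c (coord c (\<gamma> (fst r))) (snd r)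
        + (1 - fst r) * hess_in c (coord c (\<gamma> (fst r))) (velocity M \<gamma> (fst r) c) (snd r)
        - b (fst r) * sqrt (hess_in c (coord c (\<gamma> (fst r))) (snd r) (snd r))" for r
    have VN: "V s w = N (s, w c)" if "\<gamma> s \<in> D" "c \<in> charts_at M (\<gamma> s)" "w \<in> tangent_space M (\<gamma> s)" for s w
      unfolding V_def N_def
      by (simp add: differential_in_chart[OF that] hessian_in_chart[OF that(1,2) that(3,3)]
          hessian_in_chart[OF that(1,2) vT that(3)])
    have ev: "\<forall>\<^sub>F r in nhds (t, u). N r < 0" if u: "u \<in> sphere 0 1" for u
    proof -
      have X0: "isCont (\<lambda>r. coord c (\<gamma> (fst r))) (t, u)"
        by (rule isCont_o2[OF continuous_fst[OF continuous_ident]])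
           (use has_vector_derivative_continuous[OF geodesic_velocity(1)[OF \<gamma> c]] in simp)
      then have X: "isCont (\<lambda>r. (coord c (\<gamma> (fst r)), snd r)) (t, u)" by (intro continuous_intros)
      have V: "isCont (\<lambda>r. velocity M \<gamma> (fst r) c) (t, u)"
        by (rule isCont_o2[OF continuous_fst[OF continuous_ident]])
           (use has_vector_derivative_continuous[OF geodesic_velocity(2)[OF \<gamma> c]] in simp)
      have X2: "isCont (\<lambda>r. ((coord c (\<gamma> (fst r)), velocity M \<gamma> (fst r) c), snd r)) (t, u)"
        using X0 V by (intro continuous_intros)
      have X3: "isCont (\<lambda>r. ((coord c (\<gamma> (fst r)), snd r), snd r)) (t, u)"
        using X0 by (intro continuous_intros)
      have 1: "isCont (\<lambda>r. diff_in c (coord c (\<gamma> (fst r))) (snd r)) (t, u)"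
        using isCont_o2[OF X, of "\<lambda>q. diff_in c (fst q) (snd q)"]
          linear_family_isCont[OF open_dom_in[OF ca] x diff_in_linear[OF ca] diff_in_differentiable[OF ca x]]
        by simp
      have hb: "isCont (\<lambda>q. hess_in c (fst (fst q)) (snd (fst q)) (snd q)) ((coord c (\<gamma> t), a), a')" for a a'
        by (rule bilinear_family_isCont[OF open_dom_in[OF ca] x hess_in_bilinear[OF ca] hess_in_differentiable[OF ca x]])
      have 2: "isCont (\<lambda>r. hess_in c (coord c (\<gamma> (fst r))) (velocity M \<gamma> (fst r) c) (snd r)) (t, u)"
        using isCont_o2[OF X2, of "\<lambda>q. hess_in c (fst (fst q)) (snd (fst q)) (snd q)"] hb by simp
      have 3: "isCont (\<lambda>r. hess_in c (coord c (\<gamma> (fst r))) (snd r) (snd r)) (t, u)"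
        using isCont_o2[OF X3, of "\<lambda>q. hess_in c (fst (fst q)) (snd (fst q)) (snd q)"] hb by simp
      have 4: "isCont (\<lambda>r. b (fst r)) (t, u)"
        by (rule isCont_o2[OF continuous_fst[OF continuous_ident]]) (use DERIV_isCont[OF db[of t]] t in simp)
      have "isCont N (t, u)" unfolding N_def
        by (intro continuous_intros 1 2 3 4)
      then have "(N \<longlongrightarrow> N (t, u)) (nhds (t, u))" by (rule isCont_tendsto_nhds)
      moreover have "N (t, u) < 0"
      proof -
        have u0: "u \<noteq> 0" using u by auto
        then have "V t (tvec_of M c (\<gamma> t) u) < 0"
          using Q tvec_of_in_tangent_space[OF c] tvec_of_nonzero[OF c] by blast
        then show ?thesis using VN[OF Dt c tvec_of_in_tangent_space[OF c]] by (simp add: tvec_of_apply[OF c])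
      qed
      ultimately show ?thesis by (rule order_tendstoD)
    qed
    have "\<forall>\<^sub>F s in nhds t. \<forall>u\<in>sphere 0 1. N (s, u) < 0"
      by (rule eventually_ball_compact[OF compact_sphere ev])
    then have "\<forall>\<^sub>F s in nhds t. \<forall>w\<in>tangent_space M (\<gamma> s) - {\<lambda>_. 0}. V s w < 0"
      using geodesic_eventually_chart[OF \<gamma> c] geodesic_eventually_in[OF \<gamma> open_D Dt]
    proof eventually_elim
      case (elim s)
      show ?case
      proof
        fix w assume w: "w \<in> tangent_space M (\<gamma> s) - {\<lambda>_. 0}"
        have wc: "w c \<noteq> 0" using tangent_vector_nonzero[OF elim(2)] w by blast
        define u where "u = w c /\<^sub>R norm (w c)"
        have u: "u \<in> sphere 0 1" "w c = norm (w c) *\<^sub>R u" using wc by (auto simp: u_def)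
        have xs: "coord c (\<gamma> s) \<in> dom_in c" by (rule coord_in_dom_in[OF elim(2,3)])
        have hom: "N (s, r *\<^sub>R u) = r * N (s, u)" if "0 \<le> r" for r
        proof -
          note hb = hess_in_bilinear[OF ca xs]
          have 1: "diff_in c (coord c (\<gamma> s)) (r *\<^sub>R u) = r * diff_in c (coord c (\<gamma> s)) u"
            using diff_in_linear[OF ca xs] by (simp add: linear_cmul)
          have 2: "hess_in c (coord c (\<gamma> s)) a (r *\<^sub>R u) = r * hess_in c (coord c (\<gamma> s)) a u" for a
            using hb by (simp add: bilinear_rmul)
          have "hess_in c (coord c (\<gamma> s)) (r *\<^sub>R u) (r *\<^sub>R u) = r\<^sup>2 * hess_in c (coord c (\<gamma> s)) u u"
            using hb by (simp add: bilinear_lmul bilinear_rmul power2_eq_square)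
          then have 3: "sqrt (hess_in c (coord c (\<gamma> s)) (r *\<^sub>R u) (r *\<^sub>R u))
              = r * sqrt (hess_in c (coord c (\<gamma> s)) u u)"
            using that by (simp add: real_sqrt_mult)
          show ?thesis unfolding N_def fst_conv snd_conv 3 unfolding 1 2 by (simp add: algebra_simps)
        qed
        have "V s w = norm (w c) * N (s, u)"
          using VN[OF elim(3,2)] w hom[of "norm (w c)"] u(2) by simp
        then show "V s w < 0" using elim(1) u(1) wc by (simp add: mult_pos_neg)
      qed
    qed
    then show "\<forall>\<^sub>F s in at_right t. \<forall>w\<in>tangent_space M (\<gamma> s) - {\<lambda>_. 0}. V s w < 0"
      by (rule filter_leD[OF at_within_le_nhds])
  next
    fix t :: real assume t: "0 \<le> t" "t \<le> 1"
      and Q: "\<And>s. 0 \<le> s \<Longrightarrow> s < t \<Longrightarrow> \<forall>w\<in>tangent_space M (\<gamma> s) - {\<lambda>_. 0}. V s w < 0"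
    have Dt: "\<gamma> t \<in> D" using D t by simp
    show "\<forall>w\<in>tangent_space M (\<gamma> t) - {\<lambda>_. 0}. V t w < 0"
    proof
      fix w assume w: "w \<in> tangent_space M (\<gamma> t) - {\<lambda>_. 0}"
      define h where "h = sqrt (hessian M f (\<gamma> t) w w)"
      have Hw: "0 < hessian M f (\<gamma> t) w w" using hessian_pos[OF Dt] w by blast
      then have hpos: "0 < h" by (simp add: h_def)
      have hh: "h * h = hessian M f (\<gamma> t) w w" using Hw by (simp add: h_def)
      show "V t w < 0"
      proof (cases "t = 0")
        case True
        then show ?thesis using newton[of w] w ypos[of 0] hpos \<alpha> by (simp add: V_def b_def h_def)
      next
        case False
        then have t0: "0 < t" using t by simp
        obtain W where W: "parallel_at \<gamma> t W" and Wt: "W t = w"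
          using parallel_at_extension[OF \<gamma>, of w t] w by blast
        define v where "v = velocity M \<gamma> t"
        \<comment> \<open>The derivative of \<open>V\<close> along the extension of \<open>w\<close>. The two terms \<open>hessian M f (\<gamma> t) v w\<close> cancel, which is
          the reason for the weight \<open>1 - t\<close> in \<open>V\<close>.\<close>
        define d where "d = hessian M f (\<gamma> t) v w
          + ((1 - t) * third_deriv M f (\<gamma> t) v v w - hessian M f (\<gamma> t) v w)
          - (b' t * h + b t * (third_deriv M f (\<gamma> t) v w w / (2 * h)))"
        have dW: "((\<lambda>s. hessian M f (\<gamma> s) (W s) (W s)) has_real_derivative third_deriv M f (\<gamma> t) v w w) (at t)"
          using hessian_along_geodesic[OF \<gamma> Dt W W] unfolding v_def Wt .
        have dV: "((\<lambda>s. V s (W s)) has_real_derivative d) (at t)"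
        proof -
          have 1: "((\<lambda>s. differential M f (\<gamma> s) (W s)) has_real_derivative hessian M f (\<gamma> t) v w) (at t)"
            using differential_along_geodesic[OF \<gamma> Dt W] unfolding v_def Wt .
          have 2: "((\<lambda>s. hessian M f (\<gamma> s) (velocity M \<gamma> s) (W s)) has_real_derivative third_deriv M f (\<gamma> t) v v w) (at t)"
            using hessian_along_geodesic[OF \<gamma> Dt parallel_at_velocity[OF \<gamma>] W] unfolding v_def Wt .
          have 3: "((\<lambda>s. (1 - s) * hessian M f (\<gamma> s) (velocity M \<gamma> s) (W s)) has_real_derivative
              (1 - t) * third_deriv M f (\<gamma> t) v v w - hessian M f (\<gamma> t) v w) (at t)"
            using 2 by (auto intro!: derivative_eq_intros simp: v_def Wt)
          have 4: "((\<lambda>s. sqrt (hessian M f (\<gamma> s) (W s) (W s))) has_real_derivative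
              third_deriv M f (\<gamma> t) v w w / (2 * h)) (at t)"
            using DERIV_chain2[OF DERIV_real_sqrt dW] Hw by (simp add: Wt h_def field_simps)
          have 5: "((\<lambda>s. b s * sqrt (hessian M f (\<gamma> s) (W s) (W s))) has_real_derivative
              b' t * h + b t * (third_deriv M f (\<gamma> t) v w w / (2 * h))) (at t)"
            using DERIV_mult[OF db[OF t(2)] 4] by (simp add: Wt h_def algebra_simps)
          show ?thesis unfolding V_def d_def by (rule DERIV_diff[OF DERIV_add[OF 1 3] 5])
        qed
        define m where "m = \<mu> / (1 - t * \<mu>)"
        define \<sigma> where "\<sigma> = sqrt (hessian M f (\<gamma> t) v v)"
        have mpos: "0 < m" using den[OF t(2)] \<mu> by (simp add: m_def)
        have \<sigma>0: "0 \<le> \<sigma>" using hessian_nonneg[OF Dt vT] by (simp add: \<sigma>_def v_def)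
        have \<sigma>: "\<sigma> \<le> sqrt \<alpha> * m"
        proof -
          have "\<sigma> \<le> sqrt (\<alpha> * m\<^sup>2)" unfolding \<sigma>_def v_def m_def using h[OF t] by (rule real_sqrt_le_mono)
          then show ?thesis using mpos by (simp add: real_sqrt_mult)
        qed
        have bpos: "0 < b t" unfolding b_def using \<alpha> ypos[OF t] den[OF t(2)] by simp
        have third1: "third_deriv M f (\<gamma> t) v v w \<le> 2 * sqrt \<alpha> * m\<^sup>2 * h"
        proof -
          have "third_deriv M f (\<gamma> t) v v w \<le> 2 / sqrt \<alpha> * (\<sigma> * \<sigma>) * h"
            using third_bound[OF Dt, of v v w] vT[of t] w by (simp add: \<sigma>_def h_def v_def mult.assoc)
          also have "\<dots> \<le> 2 / sqrt \<alpha> * ((sqrt \<alpha> * m) * (sqrt \<alpha> * m)) * h"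
            using \<sigma> \<sigma>0 \<alpha> hpos mpos by (intro mult_right_mono mult_left_mono mult_mono) auto
          also have "\<dots> = 2 * sqrt \<alpha> * m\<^sup>2 * h" using \<alpha> by (simp add: power2_eq_square field_simps)
          finally show ?thesis .
        qed
        have third2: "- (third_deriv M f (\<gamma> t) v w w / (2 * h)) \<le> m * h"
        proof -
          have "- third_deriv M f (\<gamma> t) v w w \<le> 2 / sqrt \<alpha> * \<sigma> * (h * h)"
            using third_bound[OF Dt, of v w w] vT[of t] w by (simp add: \<sigma>_def h_def v_def mult.assoc)
          also have "\<dots> \<le> 2 / sqrt \<alpha> * (sqrt \<alpha> * m) * (h * h)"
            using \<sigma> \<alpha> hpos by (intro mult_right_mono mult_left_mono) auto
          also have "\<dots> = 2 * m * (h * h)" using \<alpha> by simp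
          finally show ?thesis using hpos by (simp add: field_simps)
        qed
        have "d = (1 - t) * third_deriv M f (\<gamma> t) v v w - b' t * h
             + b t * (- (third_deriv M f (\<gamma> t) v w w / (2 * h)))"
          unfolding d_def by simp
        also have "\<dots> \<le> (1 - t) * (2 * sqrt \<alpha> * m\<^sup>2 * h) - b' t * h + b t * (m * h)"
          using mult_left_mono[OF third1, of "1 - t"] mult_left_mono[OF third2, of "b t"] t bpos by linarith
        also have "\<dots> = h * sqrt \<alpha> * ((2 - 2 * t) * m\<^sup>2 - (\<eta> + (2 - 2 * t) * (\<mu>\<^sup>2 / (1 - \<mu>))) / (1 - t * \<mu>))"
          unfolding b'_def b_def m_def by (simp add: power2_eq_square algebra_simps)
        also have "\<dots> < 0"
        proof (rule mult_pos_neg)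
          show "0 < h * sqrt \<alpha>" using hpos \<alpha> by simp
          have "\<mu>\<^sup>2 / (1 - t * \<mu>) \<le> \<mu>\<^sup>2 / (1 - \<mu>)"
            using den[OF t(2)] \<mu> t by (intro divide_left_mono) auto
          then have "(2 - 2 * t) * (\<mu>\<^sup>2 / (1 - t * \<mu>)) \<le> (2 - 2 * t) * (\<mu>\<^sup>2 / (1 - \<mu>))"
            using t by (intro mult_left_mono) auto
          then have "(2 - 2 * t) * (\<mu>\<^sup>2 / (1 - t * \<mu>)) / (1 - t * \<mu>) < (\<eta> + (2 - 2 * t) * (\<mu>\<^sup>2 / (1 - \<mu>))) / (1 - t * \<mu>)"
            using \<eta> den[OF t(2)] by (intro divide_strict_right_mono) auto
          then show "(2 - 2 * t) * m\<^sup>2 - (\<eta> + (2 - 2 * t) * (\<mu>\<^sup>2 / (1 - \<mu>))) / (1 - t * \<mu>) < 0"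
            unfolding m_def by (simp add: power2_eq_square)
        qed
        finally have dneg: "d < 0" .
        have "\<forall>\<^sub>F s in at_left t. V s (W s) < 0"
        proof -
          have 1: "\<forall>\<^sub>F s in at_left t. 0 \<le> s \<and> s < t"
            unfolding eventually_at_left_field using t0 by (intro exI[of _ 0]) auto
          have "isCont (\<lambda>s. hessian M f (\<gamma> s) (W s) (W s)) t" using DERIV_isCont[OF dW] .
          then have "((\<lambda>s. hessian M f (\<gamma> s) (W s) (W s)) \<longlongrightarrow> hessian M f (\<gamma> t) w w) (nhds t)"
            using isCont_tendsto_nhds Wt by fastforce
          then have "\<forall>\<^sub>F s in nhds t. 0 < hessian M f (\<gamma> s) (W s) (W s)" using Hw by (rule order_tendstoD)
          then have 2: "\<forall>\<^sub>F s in at_left t. 0 < hessian M f (\<gamma> s) (W s) (W s)"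
            by (rule filter_leD[OF at_within_le_nhds])
          have "\<forall>\<^sub>F s in nhds t. W s \<in> tangent_space M (\<gamma> s)" using W by (simp add: parallel_at_def)
          then have 3: "\<forall>\<^sub>F s in at_left t. W s \<in> tangent_space M (\<gamma> s)"
            by (rule filter_leD[OF at_within_le_nhds])
          from 1 2 3 show ?thesis
          proof eventually_elim
            case (elim s)
            have "\<gamma> s \<in> D" using D[of s] elim(1) t by simp
            then have "W s \<noteq> (\<lambda>_. 0)" using hessian_zero[of "\<gamma> s"] elim(2,3) by force
            then show ?case using Q[of s] elim by blast
          qed
        qed
        then have "V t (W t) < 0" by (rule negative_derivative_imp_negative[OF dV dneg t0])
        then show ?thesis by (simp add: Wt)
      qed
    qed
  qed simp_all
  then have "V 1 w < 0" using w by blast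
  then show ?thesis by (simp add: V_def b_def y_def)
qed

text \<open>Every \<open>\<mu>\<close> between the Newton decrement \<open>\<nu>\<close> and 1 is admissible in the two barrier arguments, with
  \<open>\<delta>\<close> halfway between \<open>\<nu>\<close> and \<open>\<mu>\<close>. With the error \<open>\<eta> = \<mu> - \<nu>\<close> the bound at time 1 tends to
  \<open>(\<nu> / (1 - \<nu>))\<^sup>2\<close> as \<open>\<mu>\<close> decreases to \<open>\<nu>\<close>. For the absolute value, the estimate is applied to \<open>w\<close> and
  to its negative.\<close>

lemma newton_decrement_le:
  assumes \<gamma>: "geodesic_on M UNIV \<gamma>" and p: "p \<in> D" and \<gamma>0: "\<gamma> 0 = p"
    and v0: "velocity M \<gamma> 0 = newton_step M f p"
    and lam: "newton_decrement M f \<alpha> p < 1"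
  shows "\<gamma> 1 \<in> D \<and> newton_decrement M f \<alpha> (\<gamma> 1) \<le>
    (newton_decrement M f \<alpha> p / (1 - newton_decrement M f \<alpha> p))\<^sup>2"
proof -
  define \<nu> where "\<nu> = newton_decrement M f \<alpha> p"
  note \<nu> = newton_decrement_bounds[OF p, folded \<nu>_def]
  have inD: "\<gamma> t \<in> D" and speed: "hessian M f (\<gamma> t) (velocity M \<gamma> t) (velocity M \<gamma> t) \<le> \<alpha> * (\<mu> / (1 - t * \<mu>))\<^sup>2"
    if \<mu>: "\<nu> < \<mu>" "\<mu> < 1" and t: "0 \<le> t" "t \<le> 1" for \<mu> t
  proof -
    define \<delta> where "\<delta> = (\<nu> + \<mu>) / 2"
    have \<delta>: "\<nu> < \<delta>" "\<delta> < \<mu>" using \<mu> by (auto simp: \<delta>_def)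
    have \<delta>0: "0 < \<delta>" using \<delta> \<nu>(1) by simp
    have "\<nu>\<^sup>2 < \<delta>\<^sup>2" using \<delta> \<nu>(1) by (intro power_strict_mono) auto
    then have "\<alpha> * \<nu>\<^sup>2 < \<alpha> * \<delta>\<^sup>2" using \<alpha> by simp
    then have "hessian M f (\<gamma> 0) (velocity M \<gamma> 0) (velocity M \<gamma> 0) < \<alpha> * \<delta>\<^sup>2"
      using \<nu>(2) unfolding \<gamma>0 v0 by linarith
    from geodesic_stays_in_domain[OF \<gamma> _ \<delta>0 \<delta>(2) \<mu>(2) this t]
    have g: "\<gamma> t \<in> D" "hessian M f (\<gamma> t) (velocity M \<gamma> t) (velocity M \<gamma> t) < \<alpha> * (\<delta> / (1 - t * \<mu>))\<^sup>2"
      using p \<gamma>0 by auto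
    show "\<gamma> t \<in> D" by (rule g)
    have "t * \<mu> \<le> 1 * \<mu>" using t \<delta> \<delta>0 by (intro mult_right_mono) auto
    then have "0 < 1 - t * \<mu>" using \<mu> by linarith
    then have "\<alpha> * (\<delta> / (1 - t * \<mu>))\<^sup>2 \<le> \<alpha> * (\<mu> / (1 - t * \<mu>))\<^sup>2"
      using \<alpha> \<delta> \<delta>0 by (intro mult_left_mono power_mono divide_right_mono) auto
    then show "hessian M f (\<gamma> t) (velocity M \<gamma> t) (velocity M \<gamma> t) \<le> \<alpha> * (\<mu> / (1 - t * \<mu>))\<^sup>2"
      using g(2) by simp
  qed
  have D1: "\<gamma> 1 \<in> D" using inD[of "(\<nu> + 1) / 2" 1] lam by (simp add: \<nu>_def)
  have bound: "\<bar>differential M f (\<gamma> 1) w\<bar> / sqrt (\<alpha> * hessian M f (\<gamma> 1) w w)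
      \<le> (2 * (\<mu> - \<nu>) + \<mu>\<^sup>2 / (1 - \<mu>)) / (1 - \<mu>)"
    if w: "w \<in> tangent_space M (\<gamma> 1) - {\<lambda>_. 0}" and \<mu>: "\<nu> < \<mu>" "\<mu> < 1" for w \<mu>
  proof -
    define R where "R = (2 * (\<mu> - \<nu>) + \<mu>\<^sup>2 / (1 - \<mu>)) / (1 - \<mu>)"
    have \<mu>0: "0 < \<mu>" using \<mu> \<nu>(1) by simp
    have up: "differential M f (\<gamma> 1) w < sqrt \<alpha> * R * sqrt (hessian M f (\<gamma> 1) w w)"
      if "w \<in> tangent_space M (\<gamma> 1)" "w \<noteq> (\<lambda>_. 0)" for w
      unfolding R_def
      by (rule differential_barrier[OF \<gamma> \<mu>0 \<mu>(2) _ inD[OF \<mu>] speed[OF \<mu>] _ that])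
         (use \<mu> newton_step_equation(2)[OF p] \<gamma>0 v0 in simp_all)
    define c where "c = chart_at M (\<gamma> 1)"
    have c: "c \<in> charts_at M (\<gamma> 1)" unfolding c_def by (rule chart_at_in)
    have ca: "c \<in> atlas M" using c by (simp add: charts_at_def)
    have x: "coord c (\<gamma> 1) \<in> dom_in c" by (rule coord_in_dom_in[OF c D1])
    define w' where "w' = tvec_of M c (\<gamma> 1) (- w c)"
    have w': "w' \<in> tangent_space M (\<gamma> 1)" unfolding w'_def by (rule tvec_of_in_tangent_space[OF c])
    have w'c: "w' c = - w c" unfolding w'_def by (rule tvec_of_apply[OF c])
    have w'0: "w' \<noteq> (\<lambda>_. 0)"
      unfolding w'_def using tvec_of_nonzero[OF c] tangent_vector_nonzero[OF c] w by simp
    have wT: "w \<in> tangent_space M (\<gamma> 1)" using w by blast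
    have "differential M f (\<gamma> 1) w' = - differential M f (\<gamma> 1) w"
      using linear_neg[OF diff_in_linear[OF ca x]] by (simp add: differential_in_chart[OF D1 c] w' wT w'c)
    moreover have "hessian M f (\<gamma> 1) w' w' = hessian M f (\<gamma> 1) w w"
      using hess_in_bilinear[OF ca x]
      by (simp add: hessian_in_chart[OF D1 c] w' wT w'c bilinear_lneg bilinear_rneg)
    ultimately have "\<bar>differential M f (\<gamma> 1) w\<bar> \<le> sqrt \<alpha> * R * sqrt (hessian M f (\<gamma> 1) w w)"
      using up[OF w' w'0] up[of w] w by simp
    then show ?thesis unfolding R_def[symmetric] real_sqrt_mult
      using hessian_pos[OF D1, of w] w \<alpha> by (simp add: field_simps)
  qed
  have lim: "((\<lambda>\<mu>. (2 * (\<mu> - \<nu>) + \<mu>\<^sup>2 / (1 - \<mu>)) / (1 - \<mu>)) \<longlongrightarrow> (\<nu> / (1 - \<nu>))\<^sup>2) (at_right \<nu>)"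
  proof -
    have "((\<lambda>\<mu>. (2 * (\<mu> - \<nu>) + \<mu>\<^sup>2 / (1 - \<mu>)) / (1 - \<mu>)) \<longlongrightarrow> (2 * (\<nu> - \<nu>) + \<nu>\<^sup>2 / (1 - \<nu>)) / (1 - \<nu>)) (at_right \<nu>)"
      using lam by (intro tendsto_intros) (auto simp: \<nu>_def)
    then show ?thesis by (simp add: power2_eq_square)
  qed
  have "newton_decrement M f \<alpha> (\<gamma> 1) \<le> (\<nu> / (1 - \<nu>))\<^sup>2"
    unfolding newton_decrement_def
  proof (rule cSUP_least[OF nonzero_tangent_vector])
    fix w assume w: "w \<in> tangent_space M (\<gamma> 1) - {\<lambda>_. 0}"
    have "\<forall>\<^sub>F \<mu> in at_right \<nu>. \<nu> < \<mu> \<and> \<mu> < 1"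
      unfolding eventually_at_right_field using lam by (intro exI[of _ 1]) (auto simp: \<nu>_def)
    then have "\<forall>\<^sub>F \<mu> in at_right \<nu>. \<bar>differential M f (\<gamma> 1) w\<bar> / sqrt (\<alpha> * hessian M f (\<gamma> 1) w w)
        \<le> (2 * (\<mu> - \<nu>) + \<mu>\<^sup>2 / (1 - \<mu>)) / (1 - \<mu>)"
      by eventually_elim (use bound[OF w] in blast)
    then show "\<bar>differential M f (\<gamma> 1) w\<bar> / sqrt (\<alpha> * hessian M f (\<gamma> 1) w w) \<le> (\<nu> / (1 - \<nu>))\<^sup>2"
      by (rule tendsto_lowerbound[OF lim]) simp
  qed
  then show ?thesis using D1 unfolding \<nu>_def by blast
qed

end

theorem theorem1p2:
  fixes M :: "('m::{t2_space, second_countable_topology}, 'e::euclidean_space) riemannian"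
    and D :: "'m set" and f :: "'m \<Rightarrow> real" and \<alpha> :: real and p :: 'm
  assumes "riemannian_manifold M"
    and "connected (UNIV :: 'm set)"
    and "geodesically_complete M"
    and "\<alpha> > 0"
    and "strongly_self_concordant M D f \<alpha>"
    and "pos_def_hessian_on M D f"
    and "p \<in> D"
    and "newton_decrement M f \<alpha> p < 1"
  shows "newton_iterate M f p \<in> D \<and>
    newton_decrement M f \<alpha> (newton_iterate M f p) \<le>
      (newton_decrement M f \<alpha> p / (1 - newton_decrement M f \<alpha> p))\<^sup>2"
proof -
  interpret self_concordant_mfd M D f \<alpha>
  proof
    show "riemannian_manifold M" "geodesically_complete M" "\<alpha> > 0" by fact+
    show "open D" "smooth_function_on M D f" "closed {(q, t). q \<in> D \<and> f q \<le> t}"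
      using assms(5)
      unfolding strongly_self_concordant_def self_concordant_def closed_geod_convex_on_def by auto
    show "\<bar>third_deriv M f q u v w\<bar> \<le> 2 / sqrt \<alpha> *
          sqrt (hessian M f q u u) * sqrt (hessian M f q v v) * sqrt (hessian M f q w w)"
      if "q \<in> D" "u \<in> tangent_space M q" "v \<in> tangent_space M q" "w \<in> tangent_space M q" for q u v w
      using assms(5) that unfolding strongly_self_concordant_def self_concordant_def by blast
    show "0 < hessian M f q u u" if "q \<in> D" "u \<in> tangent_space M q" "u \<noteq> (\<lambda>_. 0)" for q u
      using assms(6) that unfolding pos_def_hessian_on_def by blast
  qed
  define \<gamma> where "\<gamma> = (SOME \<gamma>. geodesic_from M p (newton_step M f p) \<gamma>)"
  have "\<exists>\<gamma>. geodesic_from M p (newton_step M f p) \<gamma>"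
    using complete newton_step_equation(1)[OF assms(7)] unfolding geodesically_complete_def by blast
  then have "geodesic_from M p (newton_step M f p) \<gamma>" unfolding \<gamma>_def by (rule someI_ex)
  then have "geodesic_on M UNIV \<gamma>" "\<gamma> 0 = p" "velocity M \<gamma> 0 = newton_step M f p"
    unfolding geodesic_from_def by auto
  moreover have "newton_iterate M f p = \<gamma> 1" unfolding newton_iterate_def Exp_def \<gamma>_def ..
  ultimately show ?thesis using newton_decrement_le assms(7,8) by simp
qed

end
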